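(* Consider the problem $$\text{(P)}\quad \min_{x_1,\dots,x_N}\ \sum_{i\in\mathcal I} f_i(x_i)\quad\text{s.t.}\quad \sum_{i\in\mathcal I}\big(a_i^{m\top}x_i+b_i^m\big)\le 0,\quad m\in\mathcal M,$$ its sparse reformulation $$\text{(SR)}\quad \min_{x,\,y}\ \sum_{i\in\mathcal I} f_i(x_i)\quad\text{s.t.}\quad a_i^{m\top}x_i+\sum_{j\in N_i^m}(y_i^m-y_j^m)+b_i^m\le 0,\quad i\in\mathcal I,\ m\in\mathcal M_i,$$ and, for given $y$ and each $i\in\mathcal I$, the local problem $$\text{(SL}_i\text{)}\quad \min_{x_i}\ f_i(x_i)\quad\text{s.t.}\quad a_i^{m\top}x_i+\sum_{j\in N_i^m}(y_i^m-y_j^m)+b_i^m\le 0,\quad m\in\mathcal M_i.$$ Assume that: (A1) each $f_i$ is convex; (A2) the optimal value of (P) is finite; (A3) for every $y$ and every $i\in\mathcal I$ there exists $x_i$ that is strictly feasible for (SL$_i$); (A4) the communication graph $\mathcal G$ is consistent with all constraints, i.e. for every $m\in\mathcal M$ the subgraph $\mathcal G_m$ of $\mathcal G$ induced by $\mathcal I_m$ is connected. Let $c_i=(c_i^1,\dots,c_i^M)$, where $c_i^m$ is the Lagrange multiplier of the $m$-th constraint of (SL$_i$) if $m\in\mathcal M_i$, and $c_i^m=0$ otherwise. Suppose that $y_i(t)=(y_i^1(t),\dots,y_i^M(t))$ is updated, for almost all $t$, according to $$\dot y_i^m=\begin{cases}-k_0\sum_{j\in N_i^m}(c_i^m-c_j^m),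 & m\in\mathcal M_i,\\ 0,& m\notin\mathcal M_i,\end{cases}$$ where $k_0>0$ is a constant gain, and that a Caratheodory solution exists. Then: 1) the Caratheodory solution is unique and converges to the set of optimal $y$ of (SR); 2) the solution to the local problems (SL$_i$), $i\in\mathcal I$ (with $y=y(t)$), asymptotically converges to (one of) the optimal solution(s) of (P); 3) the coupling constraints in (P) hold during the solution evolution, i.e. for all $t$ the stacked vector of the solutions of the local problems (SL$_i$) with $y=y(t)$ is feasible for (P).
   Context: $\mathcal I=\{1,\dots,N\}$ indexes agents and $\mathcal M=\{1,\dots,M\}$ indexes coupling constraints; $a_i^m,x_i\in\mathbb R^{d_i}$, $b_i^m\in\mathbb R$, $f_i:\mathbb R^{d_i}\to\mathbb R$. $\mathcal G=(\mathcal I,E)$ is a connected undirected graph and $N_i$ is the set of neighbors of $i$ in $\mathcal G$. Define $\mathcal I_m=\{i\in\mathcal I: a_i^m\ne 0\text{ or }b_i^m\neq 0\}$, $\mathcal M_i=\{m\in\mathcal M: a_i^m\neq 0\text{ or }b_i^m\ne 0\}$ and $N_i^m=N_i\cap\mathcal I_m$. The induced subgraph is $\mathcal G_m=(\mathcal I_m,E_m)$ with $(i,j)\in E_m$ iff $i,j\in\mathcal I_m$ and $(i,j)\in E$. Auxiliary variables $y_i^m\in\mathbb R$ are collected as $y^m=(y_1^m,\dots,y_N^m)$, $y=[y^1;\dots;y^M]\in\mathbb R^{NM}$. Lagrange multipliers of (SL$_i$) are multipliers $c_i^m\ge0$, $m\in\mathcal M_i$, for its inequality constraints for which strong duality holds,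 i.e. the optimal value of (SL$_i$) equals the infimum over $x_i$ of the Lagrangian with these multipliers; they need not be unique, and in the update law $c_i=c_i(y)$ is the one chosen at the current $y$. The set of optimal $y$ of (SR) is the set of all $y$ for which there is an $x$ such that $(x,y)$ is optimal for (SR). A Caratheodory solution of a differential equation $\dot x=X(x)$ is an absolutely continuous function $x:[0,\infty)\to\mathbb R^n$ that satisfies the equation for almost all $t$.
   Formalization: Convergence in 1) is proved if (P) and all (SL_i) attain their minima; in 2), to one optimum if also local solutions are unique, or to the optimal set if (P)'s or all local solution sets are nonempty and bounded; otherwise only the cost converges and limit points are optimal. *)

theory Defs
  imports "HOL-Analysis.Analysis"
begin

text \<open>
  Agents are the elements of a finite type \<open>'i\<close> and coupling constraints those of a finite
  type \<open>'m\<close>, so \<open>N = CARD('i)\<close> and \<open>M = CARD('m)\<close>. The agents have decision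
  spaces of different dimensions: the space of agent \<open>i\<close> is a subspace \<open>V i\<close> of one ambient
  Euclidean space \<open>'v\<close>, and its dimension \<open>d\<^sub>i\<close> is \<open>dim (V i)\<close>. Every family of
  dimensions arises in this way, for instance from coordinate subspaces of a large enough
  \<open>real ^ 'k\<close>. Stacked vectors are \<open>x :: 'v ^ 'i\<close> with \<open>x $ i \<in> V i\<close>, and
  \<open>y :: (real ^ 'm) ^ 'i\<close> with \<open>y $ i $ m\<close> for the auxiliary variable of agent \<open>i\<close> and
  constraint \<open>m\<close>. The graph is given by its set \<open>E\<close> of adjacent pairs.
\<close>

definition active_agents ::
    "('i \<Rightarrow> 'm \<Rightarrow> 'v::euclidean_space) \<Rightarrow> ('i \<Rightarrow> 'm \<Rightarrow> real) \<Rightarrow> 'm \<Rightarrow> 'i set" where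
  "active_agents a b m = {i. a i m \<noteq> 0 \<or> b i m \<noteq> 0}"

definition active_constraints ::
    "('i \<Rightarrow> 'm \<Rightarrow> 'v::euclidean_space) \<Rightarrow> ('i \<Rightarrow> 'm \<Rightarrow> real) \<Rightarrow> 'i \<Rightarrow> 'm set" where
  "active_constraints a b i = {m. a i m \<noteq> 0 \<or> b i m \<noteq> 0}"

definition active_neighbors ::
    "('i \<Rightarrow> 'm \<Rightarrow> 'v::euclidean_space) \<Rightarrow> ('i \<Rightarrow> 'm \<Rightarrow> real) \<Rightarrow> ('i \<times> 'i) set \<Rightarrow>
      'i \<Rightarrow> 'm \<Rightarrow> 'i set" where
  "active_neighbors a b E i m = {j. (i, j) \<in> E} \<inter> active_agents a b m"

text \<open>Connectedness of the subgraph of \<open>E\<close> induced by the vertex set \<open>W\<close>.\<close>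

definition induced_connected :: "'i set \<Rightarrow> ('i \<times> 'i) set \<Rightarrow> bool" where
  "induced_connected W E \<longleftrightarrow> (\<forall>u\<in>W. \<forall>v\<in>W. (u, v) \<in> (E \<inter> W \<times> W)\<^sup>*)"

definition total_cost :: "('i::finite \<Rightarrow> 'v::euclidean_space \<Rightarrow> real) \<Rightarrow> 'v ^ 'i \<Rightarrow> real" where
  "total_cost f x = (\<Sum>i\<in>UNIV. f i (x $ i))"

definition P_feasible ::
    "('i::finite \<Rightarrow> 'v::euclidean_space set) \<Rightarrow> ('i \<Rightarrow> 'm \<Rightarrow> 'v) \<Rightarrow> ('i \<Rightarrow> 'm \<Rightarrow> real) \<Rightarrow>
      ('v ^ 'i) set" where
  "P_feasible V a b =
    {x. (\<forall>i. x $ i \<in> V i) \<and> (\<forall>m. (\<Sum>i\<in>UNIV. a i m \<bullet> (x $ i) + b i m) \<le> 0)}"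

definition P_value ::
    "('i::finite \<Rightarrow> 'v::euclidean_space set) \<Rightarrow> ('i \<Rightarrow> 'v \<Rightarrow> real) \<Rightarrow> ('i \<Rightarrow> 'm \<Rightarrow> 'v) \<Rightarrow>
      ('i \<Rightarrow> 'm \<Rightarrow> real) \<Rightarrow> ereal" where
  "P_value V f a b = (INF x \<in> P_feasible V a b. ereal (total_cost f x))"

definition P_optimal ::
    "('i::finite \<Rightarrow> 'v::euclidean_space set) \<Rightarrow> ('i \<Rightarrow> 'v \<Rightarrow> real) \<Rightarrow> ('i \<Rightarrow> 'm \<Rightarrow> 'v) \<Rightarrow>
      ('i \<Rightarrow> 'm \<Rightarrow> real) \<Rightarrow> ('v ^ 'i) set" where
  "P_optimal V f a b = {x. is_arg_min (total_cost f) (\<lambda>x. x \<in> P_feasible V a b) x}"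

definition local_constraint ::
    "('i \<Rightarrow> 'm \<Rightarrow> 'v::euclidean_space) \<Rightarrow> ('i \<Rightarrow> 'm \<Rightarrow> real) \<Rightarrow> ('i::finite \<times> 'i) set \<Rightarrow>
      (real ^ 'm) ^ 'i \<Rightarrow> 'i \<Rightarrow> 'm::finite \<Rightarrow> 'v \<Rightarrow> real" where
  "local_constraint a b E y i m z =
    a i m \<bullet> z + (\<Sum>j \<in> active_neighbors a b E i m. y $ i $ m - y $ j $ m) + b i m"

definition SR_feasible ::
    "('i::finite \<Rightarrow> 'v::euclidean_space set) \<Rightarrow> ('i \<Rightarrow> 'm::finite \<Rightarrow> 'v) \<Rightarrow> ('i \<Rightarrow> 'm \<Rightarrow> real) \<Rightarrow>
      ('i \<times> 'i) set \<Rightarrow> (('v ^ 'i) \<times> ((real ^ 'm) ^ 'i)) set" where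
  "SR_feasible V a b E =
    {(x, y). (\<forall>i. x $ i \<in> V i) \<and>
      (\<forall>i. \<forall>m \<in> active_constraints a b i. local_constraint a b E y i m (x $ i) \<le> 0)}"

definition SR_optimal_y ::
    "('i::finite \<Rightarrow> 'v::euclidean_space set) \<Rightarrow> ('i \<Rightarrow> 'v \<Rightarrow> real) \<Rightarrow> ('i \<Rightarrow> 'm::finite \<Rightarrow> 'v) \<Rightarrow>
      ('i \<Rightarrow> 'm \<Rightarrow> real) \<Rightarrow> ('i \<times> 'i) set \<Rightarrow> ((real ^ 'm) ^ 'i) set" where
  "SR_optimal_y V f a b E =
    {y. \<exists>x. is_arg_min (\<lambda>(x, y). total_cost f x) (\<lambda>p. p \<in> SR_feasible V a b E) (x, y)}"

definition SL_feasible ::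
    "('i::finite \<Rightarrow> 'v::euclidean_space set) \<Rightarrow> ('i \<Rightarrow> 'm::finite \<Rightarrow> 'v) \<Rightarrow> ('i \<Rightarrow> 'm \<Rightarrow> real) \<Rightarrow>
      ('i \<times> 'i) set \<Rightarrow> (real ^ 'm) ^ 'i \<Rightarrow> 'i \<Rightarrow> 'v set" where
  "SL_feasible V a b E y i =
    {z \<in> V i. \<forall>m \<in> active_constraints a b i. local_constraint a b E y i m z \<le> 0}"

definition SL_strictly_feasible ::
    "('i::finite \<Rightarrow> 'v::euclidean_space set) \<Rightarrow> ('i \<Rightarrow> 'm::finite \<Rightarrow> 'v) \<Rightarrow> ('i \<Rightarrow> 'm \<Rightarrow> real) \<Rightarrow>
      ('i \<times> 'i) set \<Rightarrow> (real ^ 'm) ^ 'i \<Rightarrow> 'i \<Rightarrow> 'v set" where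
  "SL_strictly_feasible V a b E y i =
    {z \<in> V i. \<forall>m \<in> active_constraints a b i. local_constraint a b E y i m z < 0}"

definition SL_optimal ::
    "('i::finite \<Rightarrow> 'v::euclidean_space set) \<Rightarrow> ('i \<Rightarrow> 'v \<Rightarrow> real) \<Rightarrow> ('i \<Rightarrow> 'm::finite \<Rightarrow> 'v) \<Rightarrow>
      ('i \<Rightarrow> 'm \<Rightarrow> real) \<Rightarrow> ('i \<times> 'i) set \<Rightarrow> (real ^ 'm) ^ 'i \<Rightarrow> 'i \<Rightarrow> 'v set" where
  "SL_optimal V f a b E y i = {z. is_arg_min (f i) (\<lambda>z. z \<in> SL_feasible V a b E y i) z}"

definition SL_multiplier ::
    "('i::finite \<Rightarrow> 'v::euclidean_space set) \<Rightarrow> ('i \<Rightarrow> 'v \<Rightarrow> real) \<Rightarrow> ('i \<Rightarrow> 'm::finite \<Rightarrow> 'v) \<Rightarrow>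
      ('i \<Rightarrow> 'm \<Rightarrow> real) \<Rightarrow> ('i \<times> 'i) set \<Rightarrow> (real ^ 'm) ^ 'i \<Rightarrow> 'i \<Rightarrow> real ^ 'm \<Rightarrow> bool" where
  "SL_multiplier V f a b E y i \<mu> \<longleftrightarrow>
    (\<forall>m \<in> active_constraints a b i. \<mu> $ m \<ge> 0) \<and>
    (INF z \<in> SL_feasible V a b E y i. ereal (f i z)) =
    (INF z \<in> V i. ereal (f i z +
        (\<Sum>m \<in> active_constraints a b i. \<mu> $ m * local_constraint a b E y i m z)))"

definition update_law ::
    "('i::finite \<Rightarrow> 'm::finite \<Rightarrow> 'v::euclidean_space) \<Rightarrow> ('i \<Rightarrow> 'm \<Rightarrow> real) \<Rightarrow> ('i \<times> 'i) set \<Rightarrow>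
      real \<Rightarrow> ((real ^ 'm) ^ 'i \<Rightarrow> (real ^ 'm) ^ 'i) \<Rightarrow> (real ^ 'm) ^ 'i \<Rightarrow> (real ^ 'm) ^ 'i" where
  "update_law a b E k\<^sub>0 c y =
    (\<chi> i m. if m \<in> active_constraints a b i
            then - k\<^sub>0 * (\<Sum>j \<in> active_neighbors a b E i m. c y $ i $ m - c y $ j $ m)
            else 0)"

text \<open>
  A finite set of pairs \<open>(u, v)\<close> stands for a finite family of non-overlapping intervals
  \<open>[u, v]\<close>. On the unbounded interval \<open>[0, \<infinity>)\<close>, absolute continuity means absolute
  continuity on every compact subinterval.
\<close>

definition abs_continuous_on :: "real set \<Rightarrow> (real \<Rightarrow> 'a::metric_space) \<Rightarrow> bool" where
  "abs_continuous_on S g \<longleftrightarrow>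
    (\<forall>\<epsilon>>0. \<exists>\<delta>>0. \<forall>D :: (real \<times> real) set.
      finite D \<and> (\<forall>(u, v) \<in> D. u \<le> v \<and> {u..v} \<subseteq> S) \<and>
      pairwise (\<lambda>p q. {fst p<..<snd p} \<inter> {fst q<..<snd q} = {}) D \<and>
      (\<Sum>(u, v) \<in> D. v - u) < \<delta> \<longrightarrow>
      (\<Sum>(u, v) \<in> D. dist (g u) (g v)) < \<epsilon>)"

definition caratheodory_solution ::
    "('a::real_normed_vector \<Rightarrow> 'a) \<Rightarrow> (real \<Rightarrow> 'a) \<Rightarrow> bool" where
  "caratheodory_solution X y \<longleftrightarrow>
    (\<forall>T\<ge>0. abs_continuous_on {0..T} y) \<and>
    (AE t in lebesgue. t \<ge> 0 \<longrightarrow> (y has_vector_derivative X (y t)) (at t within {0..}))"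

end

theory Submission
  imports Defs
begin

text \<open>
  Let \<open>p v\<close> be the sum of the optimal values \<open>q\<^sub>i v\<close> of the local problems at \<open>v\<close>. Lagrange multipliers
  of the local problems are sensitivities, so \<open>q\<^sub>i v + (\<Sum>m. c\<^sub>i\<^sup>m * L\<^sub>i\<^sup>m (w - v)) \<le> q\<^sub>i w\<close>, where
  \<open>L\<^sub>i\<^sup>m\<close> is the Laplacian of the induced subgraph of constraint \<open>m\<close>. Summation by parts moves the
  Laplacian onto the multipliers, and the update law turns out to be \<open>y' = - k\<^sub>0 g y\<close> with \<open>g\<close> a
  selection of the subdifferential of the finite convex function \<open>p\<close>. Monotonicity of the
  subdifferential gives uniqueness, \<open>p\<close> decreases along the flow, and
  \<open>2 k\<^sub>0 T (p (y T) - p z) \<le> |y 0 - z|\<^sup>2\<close> yields \<open>p (y t) \<rightarrow> inf p\<close>; when a minimizer exists, distances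
  to minimizers are nonincreasing, so \<open>y\<close> converges to one of them.

  The Laplacian terms cancel in the sum over the agents, so local feasibility implies feasibility
  for (P). Conversely, the Laplacian of a connected graph has the vectors of sum zero as its range,
  so every feasible point of (P) is locally feasible for some \<open>v\<close>. Hence \<open>inf p\<close> is the value of (P).
\<close>

section \<open>Absolutely continuous functions\<close>

definition nonoverlapping :: "real set \<Rightarrow> (real \<times> real) set \<Rightarrow> bool" where
  "nonoverlapping S D \<longleftrightarrow> finite D \<and> (\<forall>(u, v) \<in> D. u \<le> v \<and> {u..v} \<subseteq> S) \<and>
    pairwise (\<lambda>p q. {fst p<..<snd p} \<inter> {fst q<..<snd q} = {}) D"

lemma nonoverlapping_mono: "nonoverlapping S D \<Longrightarrow> S \<subseteq> T \<Longrightarrow> nonoverlapping T D"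
  unfolding nonoverlapping_def by blast

lemma abs_continuous_onD:
  assumes "abs_continuous_on S g" "e > 0"
  obtains d where "d > 0"
    "\<forall>D. nonoverlapping S D \<longrightarrow> (\<Sum>(u, v) \<in> D. v - u) < d \<longrightarrow>
      (\<Sum>(u, v) \<in> D. dist (g u) (g v)) < e"
  using assms unfolding abs_continuous_on_def nonoverlapping_def by meson

lemma abs_continuous_on_imp_continuous_on:
  assumes "abs_continuous_on {A..B} g"
  shows "continuous_on {A..B} g"
  unfolding continuous_on_iff
proof (intro ballI allI impI)
  fix t and e :: real
  assume t: "t \<in> {A..B}" and e: "e > 0"
  obtain d where d: "d > 0"
    "\<forall>D. nonoverlapping {A..B} D \<longrightarrow> (\<Sum>(u, v) \<in> D. v - u) < d \<longrightarrow>
      (\<Sum>(u, v) \<in> D. dist (g u) (g v)) < e"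
    using abs_continuous_onD[OF assms e] by blast
  have "dist (g s) (g t) < e" if s: "s \<in> {A..B}" "dist s t < d" for s
  proof (cases "s \<le> t")
    case True
    then show ?thesis using d(2)[rule_format, of "{(s, t)}"] s t
      by (auto simp: nonoverlapping_def dist_real_def)
  next
    case False
    then show ?thesis using d(2)[rule_format, of "{(t, s)}"] s t
      by (auto simp: nonoverlapping_def dist_real_def dist_commute)
  qed
  with d(1) show "\<exists>d>0. \<forall>s\<in>{A..B}. dist s t < d \<longrightarrow> dist (g s) (g t) < e" by blast
qed

text \<open>A single transfer principle: increments of \<open>k\<close> dominated by those of
  \<open>g\<close> and \<open>h\<close> inherit their smallness. It covers differences and sums of
  two functions, and, with \<open>g = h\<close>, squared norms and Lipschitz compositions.\<close>

lemma abs_continuous_on_dist_le: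
  fixes g :: "real \<Rightarrow> 'a::metric_space" and h :: "real \<Rightarrow> 'b::metric_space"
    and k :: "real \<Rightarrow> 'c::metric_space"
  assumes g: "abs_continuous_on S g" and h: "abs_continuous_on S h"
    and le: "\<And>u v. u \<in> S \<Longrightarrow> v \<in> S \<Longrightarrow> dist (k u) (k v) \<le> L * (dist (g u) (g v) + dist (h u) (h v))"
  shows "abs_continuous_on S k"
  unfolding abs_continuous_on_def
proof (intro allI impI)
  fix e :: real assume e: "e > 0"
  \<comment> \<open>\<open>L\<close> may be zero or negative, so it is replaced by a larger positive
    constant before dividing by it.\<close>
  define M where "M = max L 0 + 1"
  have M: "M > 0" "L \<le> M" by (auto simp: M_def)
  have e': "e / (2 * M) > 0" using e M by simp
  obtain d1 where d1: "d1 > 0"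
    "\<forall>D. nonoverlapping S D \<longrightarrow> (\<Sum>(u, v) \<in> D. v - u) < d1 \<longrightarrow>
      (\<Sum>(u, v) \<in> D. dist (g u) (g v)) < e / (2 * M)"
    using abs_continuous_onD[OF g e'] by blast
  obtain d2 where d2: "d2 > 0"
    "\<forall>D. nonoverlapping S D \<longrightarrow> (\<Sum>(u, v) \<in> D. v - u) < d2 \<longrightarrow>
      (\<Sum>(u, v) \<in> D. dist (h u) (h v)) < e / (2 * M)"
    using abs_continuous_onD[OF h e'] by blast
  show "\<exists>\<delta>>0. \<forall>D. finite D \<and> (\<forall>(u, v)\<in>D. u \<le> v \<and> {u..v} \<subseteq> S) \<and>
            pairwise (\<lambda>p q. {fst p<..<snd p} \<inter> {fst q<..<snd q} = {}) D \<and>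
            (\<Sum>(u, v)\<in>D. v - u) < \<delta> \<longrightarrow>
            (\<Sum>(u, v)\<in>D. dist (k u) (k v)) < e"
  proof (intro exI[of _ "min d1 d2"] conjI allI impI)
    fix D :: "(real \<times> real) set"
    assume D: "finite D \<and> (\<forall>(u, v)\<in>D. u \<le> v \<and> {u..v} \<subseteq> S) \<and>
            pairwise (\<lambda>p q. {fst p<..<snd p} \<inter> {fst q<..<snd q} = {}) D \<and>
            (\<Sum>(u, v)\<in>D. v - u) < min d1 d2"
    then have "nonoverlapping S D" by (simp add: nonoverlapping_def)
    have "(\<Sum>(u, v)\<in>D. dist (k u) (k v)) \<le> (\<Sum>(u, v)\<in>D. M * (dist (g u) (g v) + dist (h u) (h v)))"
    proof (rule sum_mono, clarify)
      fix u v assume "(u, v) \<in> D"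
      with D have "u \<le> v" "{u..v} \<subseteq> S" by auto
      then have "u \<in> S" "v \<in> S" by auto
      then have "dist (k u) (k v) \<le> L * (dist (g u) (g v) + dist (h u) (h v))" by (rule le)
      also have "\<dots> \<le> M * (dist (g u) (g v) + dist (h u) (h v))"
        using M(2) by (intro mult_right_mono) auto
      finally show "dist (k u) (k v) \<le> M * (dist (g u) (g v) + dist (h u) (h v))" .
    qed
    also have "\<dots> = M * ((\<Sum>(u, v)\<in>D. dist (g u) (g v)) + (\<Sum>(u, v)\<in>D. dist (h u) (h v)))"
      by (simp add: sum_distrib_left sum.distrib case_prod_unfold distrib_left)
    also have "\<dots> < M * (e / (2 * M) + e / (2 * M))"
      using M D \<open>nonoverlapping S D\<close>
      by (intro mult_strict_left_mono add_strict_mono d1(2)[rule_format] d2(2)[rule_format]) auto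
    also have "\<dots> = e" using M by (simp add: field_simps)
    finally show "(\<Sum>(u, v)\<in>D. dist (k u) (k v)) < e" .
  qed (use d1(1) d2(1) in auto)
qed

lemma abs_continuous_on_subset:
  assumes "abs_continuous_on T g" "S \<subseteq> T"
  shows "abs_continuous_on S g"
  unfolding abs_continuous_on_def
proof (intro allI impI)
  fix e :: real assume "e > 0"
  with assms(1) obtain d where d: "d > 0" "\<forall>D. nonoverlapping T D \<longrightarrow> (\<Sum>(u, v) \<in> D. v - u) < d \<longrightarrow>
      (\<Sum>(u, v) \<in> D. dist (g u) (g v)) < e"
    by (rule abs_continuous_onD)
  show "\<exists>\<delta>>0. \<forall>D. finite D \<and> (\<forall>(u, v)\<in>D. u \<le> v \<and> {u..v} \<subseteq> S) \<and>
            pairwise (\<lambda>p q. {fst p<..<snd p} \<inter> {fst q<..<snd q} = {}) D \<and>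
            (\<Sum>(u, v)\<in>D. v - u) < \<delta> \<longrightarrow>
            (\<Sum>(u, v)\<in>D. dist (g u) (g v)) < e"
    using d nonoverlapping_mono[OF _ assms(2)] unfolding nonoverlapping_def by meson
qed

lemma abs_continuous_on_ident: "abs_continuous_on S (\<lambda>t. t)"
  unfolding abs_continuous_on_def
proof (intro allI impI exI conjI)
  fix e :: real and D :: "(real \<times> real) set"
  assume "e > 0" then show "e > 0" .
  assume D: "finite D \<and> (\<forall>(u, v)\<in>D. u \<le> v \<and> {u..v} \<subseteq> S) \<and>
            pairwise (\<lambda>p q. {fst p<..<snd p} \<inter> {fst q<..<snd q} = {}) D \<and>
            (\<Sum>(u, v)\<in>D. v - u) < e"
  have "(\<Sum>(u, v)\<in>D. dist u v) = (\<Sum>(u, v)\<in>D. v - u)"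
    using D by (intro sum.cong) (auto simp: dist_real_def)
  with D show "(\<Sum>(u, v)\<in>D. dist u v) < e" by simp
qed

text \<open>Squaring the norm is Lipschitz on bounded sets, and \<delta> is bounded because it is
  continuous on a compact interval.\<close>

lemma abs_continuous_on_norm_sq:
  fixes \<delta> :: "real \<Rightarrow> 'a::euclidean_space"
  assumes "abs_continuous_on {A..B} \<delta>"
  shows "abs_continuous_on {A..B} (\<lambda>t. (norm (\<delta> t))\<^sup>2)"
proof -
  have "compact (\<delta> ` {A..B})"
    using abs_continuous_on_imp_continuous_on[OF assms] by (intro compact_continuous_image) auto
  then have "bounded (\<delta> ` {A..B})" by (rule compact_imp_bounded)
  then obtain R where "\<forall>x\<in>\<delta> ` {A..B}. norm x \<le> R"
    unfolding bounded_iff by (rule exE)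
  then have R: "norm (\<delta> t) \<le> R" if "t \<in> {A..B}" for t using that by blast
  show ?thesis
  proof (rule abs_continuous_on_dist_le[OF assms assms, where L = R])
    fix u v assume uv: "u \<in> {A..B}" "v \<in> {A..B}"
    have "\<bar>(norm (\<delta> u))\<^sup>2 - (norm (\<delta> v))\<^sup>2\<bar> = (norm (\<delta> u) + norm (\<delta> v)) * \<bar>norm (\<delta> u) - norm (\<delta> v)\<bar>"
      by (simp add: power2_eq_square square_diff_square_factored abs_mult)
    also have "\<dots> \<le> (R + R) * norm (\<delta> u - \<delta> v)"
      using R[OF uv(1)] R[OF uv(2)] order_trans[OF norm_ge_zero R[OF uv(1)]]
      by (intro mult_mono add_mono norm_triangle_ineq3) auto
    finally show "dist ((norm (\<delta> u))\<^sup>2) ((norm (\<delta> v))\<^sup>2) \<le> R * (dist (\<delta> u) (\<delta> v) + dist (\<delta> u) (\<delta> v))"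
      by (simp add: dist_norm algebra_simps)
  qed
qed

text \<open>The open intervals are disjoint subsets of \<open>U\<close>, so their total length is at
  most the measure of \<open>U\<close>. This turns a small neighbourhood of a null set into an
  admissible bound for absolute continuity.\<close>

lemma sum_length_nonoverlapping_less:
  assumes "nonoverlapping U D" "U \<in> sets lebesgue" "emeasure lebesgue U < ennreal d"
  shows "(\<Sum>(u, v) \<in> D. v - u) < d"
proof -
  have le: "fst p \<le> snd p" "{fst p<..<snd p} \<subseteq> U" if "p \<in> D" for p
    using assms(1) that by (fastforce simp: nonoverlapping_def)+
  have "ennreal (\<Sum>(u, v) \<in> D. v - u) = (\<Sum>p\<in>D. ennreal (snd p - fst p))"
    using le(1) by (simp add: case_prod_unfold sum_ennreal)
  also have "\<dots> = (\<Sum>p\<in>D. emeasure lebesgue {fst p<..<snd p})"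
    using le(1) by (intro sum.cong) auto
  also have "\<dots> = emeasure lebesgue (\<Union>p\<in>D. {fst p<..<snd p})"
    using assms(1)
    by (intro sum_emeasure) (auto simp: nonoverlapping_def disjoint_family_on_def pairwise_def)
  also have "\<dots> \<le> emeasure lebesgue U"
    using le(2) assms(2) by (intro emeasure_mono) auto
  also have "\<dots> < ennreal d" by fact
  finally show ?thesis
    using le(1) by (subst (asm) ennreal_less_iff) (auto simp: case_prod_unfold intro!: sum_nonneg)
qed

text \<open>
  The variation of \<open>\<phi>\<close> over an open neighbourhood \<open>U\<close> of the exceptional null set is small by
  absolute continuity. Subtracting it from \<open>\<phi>\<close> (together with a small linear term) leaves a
  function \<open>\<psi>\<close> that decreases to the left of every point, including the exceptional ones.
\<close>

lemma abs_continuous_left_dini_nonincreasing: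
  fixes \<phi> :: "real \<Rightarrow> real"
  assumes AB: "A \<le> B" and ac: "abs_continuous_on {A..B} \<phi>"
    and dini: "AE t in lebesgue. t \<in> {A<..B} \<longrightarrow>
      (\<forall>e>0. eventually (\<lambda>s. \<phi> t - \<phi> s \<le> e * (t - s)) (at_left t))"
  shows "\<phi> B \<le> \<phi> A"
proof -
  \<comment> \<open>The error splits into \<open>e\<close> for the variation near the exceptional
    set and \<open>e * (B - A)\<close> for the slope allowed elsewhere; \<open>e\<close> is
    arbitrary.\<close>
  have main: "\<phi> B - \<phi> A \<le> e * (1 + (B - A))" if e: "e > 0" for e
  proof -
    obtain d where d: "d > 0"
      "\<forall>D. nonoverlapping {A..B} D \<longrightarrow> (\<Sum>(u, v) \<in> D. v - u) < d \<longrightarrow>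
      (\<Sum>(u, v) \<in> D. dist (\<phi> u) (\<phi> v)) < e"
      using abs_continuous_onD[OF ac e] by blast
    obtain N where N: "N \<in> null_sets lebesgue"
      "\<And>t. t \<notin> N \<Longrightarrow> t \<in> {A<..B} \<Longrightarrow> eventually (\<lambda>s. \<phi> t - \<phi> s \<le> e * (t - s)) (at_left t)"
    proof (rule AE_E3[OF dini])
      fix N :: "real set"
      assume "N \<in> null_sets lebesgue"
        "\<And>t. t \<in> space lebesgue - N \<Longrightarrow> t \<in> {A<..B} \<longrightarrow>
          (\<forall>e>0. eventually (\<lambda>s. \<phi> t - \<phi> s \<le> e * (t - s)) (at_left t))"
      then show thesis using e by (intro that[of N]) auto
    qed
    have "N \<in> sets lebesgue" using N(1) by (rule null_setsD2)
    then obtain U where U: "open U" "N \<subseteq> U" "U - N \<in> lmeasurable"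
        "emeasure lebesgue (U - N) < ennreal d"
      using d(1) by (rule sets_lebesgue_outer_open)
    have Um: "U \<in> sets lebesgue" using U(1) by auto
    have Ud: "emeasure lebesgue U < ennreal d"
      using U N(1) Um emeasure_Diff_null_set[OF N(1) Um] by simp
    \<comment> \<open>\<open>\<sigma> t\<close> is the variation of \<phi> over the part of
      \<open>{A..t}\<close> inside \<open>U\<close>: \<open>F t\<close> holds the admissible
      families and \<open>S\<close> sums their increments.\<close>
    define F where "F t = Collect (nonoverlapping ({A..t} \<inter> U))" for t
    define S where "S D = (\<Sum>(u, v) \<in> D. dist (\<phi> u) (\<phi> v))" for D
    define \<sigma> where "\<sigma> t = Sup (S ` F t)" for t
    have Se: "S D \<le> e" if "D \<in> F t" "t \<le> B" for D t
    proof -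
      from that have D: "nonoverlapping ({A..t} \<inter> U) D" by (simp add: F_def)
      have "nonoverlapping U D" "nonoverlapping {A..B} D"
        by (rule nonoverlapping_mono[OF D], use that in auto)+
      with d(2) sum_length_nonoverlapping_less[OF _ Um Ud]
      have "(\<Sum>(u, v) \<in> D. dist (\<phi> u) (\<phi> v)) < e" by blast
      then show ?thesis by (simp add: S_def)
    qed
    have F0: "{} \<in> F t" for t by (simp add: F_def nonoverlapping_def)
    have bdd: "bdd_above (S ` F t)" if "t \<le> B" for t
      using Se[OF _ that] by (auto intro!: bdd_aboveI2)
    have sig_ub: "S D \<le> \<sigma> t" if "D \<in> F t" "t \<le> B" for D t
      unfolding \<sigma>_def using bdd[OF that(2)] that(1) by (intro cSUP_upper)
    have sig_B: "\<sigma> t \<le> e" if "t \<le> B" for t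
      unfolding \<sigma>_def using Se that F0 by (intro cSUP_least) auto
    have sig_0: "0 \<le> \<sigma> t" if "t \<le> B" for t
      using sig_ub[OF F0 that] by (simp add: S_def)
    have sig_mono: "\<sigma> s \<le> \<sigma> t" if "s \<le> t" "t \<le> B" for s t
    proof -
      have "F s \<subseteq> F t" using that by (auto simp: F_def elim!: nonoverlapping_mono)
      then show ?thesis unfolding \<sigma>_def using bdd[OF that(2)] F0[of s]
        by (intro cSup_subset_mono) auto
    qed
    \<comment> \<open>Any family in \<open>{A..s}\<close> can be extended by the interval from
      \<open>s\<close> to \<open>t\<close>, so \<sigma> grows at least as much as \<phi> changes
      there.\<close>
    have sig_add: "\<sigma> s + \<bar>\<phi> t - \<phi> s\<bar> \<le> \<sigma> t"
      if st: "A \<le> s" "s < t" "t \<le> B" "{s..t} \<subseteq> U" for s t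
    proof -
      have "S D \<le> \<sigma> t - \<bar>\<phi> t - \<phi> s\<bar>" if D: "D \<in> F s" for D
      proof -
        have Ds: "u \<le> v \<and> {u..v} \<subseteq> {A..s} \<inter> U" if "(u, v) \<in> D" for u v
          using D that unfolding F_def nonoverlapping_def by blast
        have Ds': "A \<le> u \<and> u \<le> v \<and> v \<le> s" if "(u, v) \<in> D" for u v
          using Ds[OF that] by auto
        have notin: "(s, t) \<notin> D" using Ds'[of s t] st by auto
        have "insert (s, t) D \<in> F t"
          unfolding F_def nonoverlapping_def
        proof (intro CollectI conjI)
          show "finite (insert (s, t) D)" using D by (simp add: F_def nonoverlapping_def)
          show "\<forall>(u, v)\<in>insert (s, t) D. u \<le> v \<and> {u..v} \<subseteq> {A..t} \<inter> U"
          proof (clarify, elim insertE)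
            fix u v assume "(u, v) = (s, t)"
            then show "u \<le> v \<and> {u..v} \<subseteq> {A..t} \<inter> U" using st by auto
          next
            fix u v assume "(u, v) \<in> D"
            from Ds[OF this] show "u \<le> v \<and> {u..v} \<subseteq> {A..t} \<inter> U" using st by auto
          qed
          have pw: "pairwise (\<lambda>p q. {fst p<..<snd p} \<inter> {fst q<..<snd q} = {}) D"
            using D by (simp add: F_def nonoverlapping_def)
          have "{s<..<t} \<inter> {fst q<..<snd q} = {} \<and> {fst q<..<snd q} \<inter> {s<..<t} = {}" if "q \<in> D" for q
            using Ds'[of "fst q" "snd q"] that by auto
          then show "pairwise (\<lambda>p q. {fst p<..<snd p} \<inter> {fst q<..<snd q} = {}) (insert (s, t) D)"
            using pw unfolding pairwise_insert fst_conv snd_conv by blast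
        qed
        from sig_ub[OF this st(3)] show ?thesis
          using notin D by (simp add: S_def F_def nonoverlapping_def dist_real_def)
      qed
      then have "\<sigma> s \<le> \<sigma> t - \<bar>\<phi> t - \<phi> s\<bar>"
        unfolding \<sigma>_def[of s] using F0 by (intro cSUP_least) auto
      then show ?thesis by simp
    qed
    define \<psi> where "\<psi> t = \<phi> t - \<sigma> t - e * t" for t
    \<comment> \<open>Induction along the reals from right to left: \<tau> is the leftmost point
      down to which the comparison with \<open>\<psi> B\<close> persists, and it has to be
      \<open>A\<close>.\<close>
    define Z where "Z = {t \<in> {A..B}. \<forall>r\<in>{t..B}. \<psi> B \<le> \<psi> r}"
    have BZ: "B \<in> Z" using AB by (auto simp: Z_def)
    have bb: "bdd_below Z" by (auto simp: Z_def intro!: bdd_belowI)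
    define \<tau> where "\<tau> = Inf Z"
    have tau: "A \<le> \<tau>" "\<tau> \<le> B"
      unfolding \<tau>_def using BZ bb by (auto intro!: cInf_greatest cInf_lower simp: Z_def)
    have right: "\<psi> B \<le> \<psi> r" if r: "\<tau> < r" "r \<le> B" for r
    proof -
      obtain z where "z \<in> Z" "z < r"
        using cInf_lessD[of Z r] r(1) BZ unfolding \<tau>_def by blast
      then show ?thesis using r by (auto simp: Z_def)
    qed
    have at_tau: "\<psi> B \<le> \<psi> \<tau>"
    proof (cases "\<tau> = B")
      case False
      with tau have tb: "\<tau> < B" by simp
      have "continuous_on {A..B} \<phi>" by (rule abs_continuous_on_imp_continuous_on[OF ac])
      then have "(\<phi> \<longlongrightarrow> \<phi> \<tau>) (at \<tau> within {A..B})"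
        using tau by (simp add: continuous_on_def)
      then have "(\<phi> \<longlongrightarrow> \<phi> \<tau>) (at \<tau> within {\<tau>..B})"
        by (rule tendsto_within_subset) (use tau in auto)
      then have lim: "(\<phi> \<longlongrightarrow> \<phi> \<tau>) (at_right \<tau>)"
        using tb by (simp add: at_within_Icc_at_right)
      \<comment> \<open>Continuity is available for \<phi> only. The monotone terms \<sigma> and
        \<open>e * r\<close> are therefore lowered to their values at \<tau> before the limit from
        the right is taken.\<close>
      have "eventually (\<lambda>r. \<psi> B + \<sigma> \<tau> + e * \<tau> \<le> \<phi> r) (at_right \<tau>)"
        using eventually_at_right_real[OF tb]
      proof eventually_elim
        case (elim r)
        then have "\<psi> B \<le> \<psi> r" "\<sigma> \<tau> \<le> \<sigma> r" "e * \<tau> \<le> e * r"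
          using right sig_mono e by auto
        then show ?case by (simp add: \<psi>_def)
      qed
      then have "\<psi> B + \<sigma> \<tau> + e * \<tau> \<le> \<phi> \<tau>"
        using lim by (intro tendsto_lowerbound) auto
      then show ?thesis by (simp add: \<psi>_def)
    qed simp
    have "\<tau> = A"
    proof (rule ccontr)
      assume "\<tau> \<noteq> A"
      with tau have At: "A < \<tau>" by simp
      \<comment> \<open>Inside \<open>U\<close> the growth of \<sigma> absorbs the increment of
        \<phi>; outside \<open>U\<close> the point is not exceptional and the linear term absorbs
        it.\<close>
      have "eventually (\<lambda>s. \<psi> \<tau> \<le> \<psi> s) (at_left \<tau>)"
      proof (cases "\<tau> \<in> U")
        case True
        then obtain \<rho> where rho: "\<rho> > 0" "ball \<tau> \<rho> \<subseteq> U" using U(1) openE by blast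
        have "eventually (\<lambda>s. s \<in> {max A (\<tau> - \<rho>)<..<\<tau>}) (at_left \<tau>)"
          using At rho by (intro eventually_at_left_real) auto
        then show ?thesis
        proof eventually_elim
          case (elim s)
          then have "{s..\<tau>} \<subseteq> U" using rho by (auto simp: subset_eq dist_real_def)
          then have "\<sigma> s + \<bar>\<phi> \<tau> - \<phi> s\<bar> \<le> \<sigma> \<tau>" using elim tau by (intro sig_add) auto
          moreover have "e * s \<le> e * \<tau>" using e elim by auto
          ultimately show ?case by (simp add: \<psi>_def)
        qed
      next
        case False
        then have "eventually (\<lambda>s. \<phi> \<tau> - \<phi> s \<le> e * (\<tau> - s)) (at_left \<tau>)"
          using N(2)[of \<tau>] U(2) At tau by auto
        with eventually_at_left_real[OF At] show ?thesis
        proof eventually_elim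
          case (elim s)
          then have "\<sigma> s \<le> \<sigma> \<tau>" using tau by (intro sig_mono) auto
          then show ?case using elim by (simp add: \<psi>_def algebra_simps)
        qed
      qed
      then obtain l where l: "l < \<tau>" "\<And>s. l < s \<Longrightarrow> s < \<tau> \<Longrightarrow> \<psi> \<tau> \<le> \<psi> s"
        unfolding eventually_at_left_field by blast
      \<comment> \<open>A point strictly between \<open>max l A\<close> and \<tau> would lie in
        \<open>Z\<close>, below the infimum of \<open>Z\<close>.\<close>
      define s where "s = (max l A + \<tau>) / 2"
      have s: "l < s" "A < s" "s < \<tau>" using l At by (auto simp: s_def field_simps)
      have "\<psi> B \<le> \<psi> r" if "r \<in> {s..B}" for r
        using that right[of r] at_tau l(2)[of r] s by (cases r \<tau> rule: linorder_cases) auto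
      then have "s \<in> Z" using s tau by (auto simp: Z_def)
      then have "\<tau> \<le> s" unfolding \<tau>_def using bb by (rule cInf_lower)
      with s show False by simp
    qed
    with at_tau have "\<phi> B - \<phi> A \<le> \<sigma> B - \<sigma> A + e * (B - A)" by (simp add: \<psi>_def algebra_simps)
    then show ?thesis using sig_B[of B] sig_0[of A] AB by (simp add: algebra_simps)
  qed
  show ?thesis
  proof (rule ccontr)
    assume "\<not> \<phi> B \<le> \<phi> A"
    then have pos: "\<phi> B - \<phi> A > 0" by simp
    define c where "c = 1 + (B - A)"
    have c: "c > 0" using AB by (simp add: c_def)
    then have "(\<phi> B - \<phi> A) / (2 * c) > 0" using pos by simp
    from main[OF this] have "\<phi> B - \<phi> A \<le> (\<phi> B - \<phi> A) / (2 * c) * c" by (simp add: c_def)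
    also have "\<dots> = (\<phi> B - \<phi> A) / 2" using c by simp
    finally show False using pos by simp
  qed
qed

section \<open>Convex functions\<close>

text \<open>Composing with a linear projection onto \<open>V\<close> extends the function convexly
  to the whole space, where finite convex functions are continuous.\<close>

lemma convex_on_subspace_continuous:
  fixes f :: "'a::euclidean_space \<Rightarrow> real"
  assumes "subspace V" "convex_on V f"
  shows "continuous_on V f"
proof -
  obtain g where g: "range g \<subseteq> V" "linear g" "\<And>v. v \<in> V \<Longrightarrow> g v = v"
    using linear_exists_left_inverse_on[OF linear_ident assms(1)] by auto
  have "convex_on UNIV (f \<circ> g)"
  proof (rule convex_onI)
    fix t :: real and x y
    assume "0 < t" "t < 1"
    moreover have "g x \<in> V" "g y \<in> V" using g(1) by auto
    ultimately show "(f \<circ> g) ((1 - t) *\<^sub>R x + t *\<^sub>R y) \<le> (1 - t) * (f \<circ> g) x + t * (f \<circ> g) y"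
      using assms(2) by (simp add: linear_add[OF g(2)] linear_scale[OF g(2)] convex_onD)
  qed simp
  then have "continuous_on UNIV (f \<circ> g)" by (intro convex_on_continuous) auto
  then have "continuous_on V (f \<circ> g)" by (rule continuous_on_subset) simp
  then show ?thesis by (rule continuous_on_eq) (simp add: g(3))
qed

lemma convex_on_pos_part:
  assumes "convex_on V f"
  shows "convex_on V (\<lambda>z. max 0 (f z) :: real)"
proof (rule convex_onI)
  fix t :: real and x y assume t: "0 < t" "t < 1" and xy: "x \<in> V" "y \<in> V"
  have "f ((1 - t) *\<^sub>R x + t *\<^sub>R y) \<le> (1 - t) * f x + t * f y"
    using t xy by (intro convex_onD[OF assms]) auto
  also have "\<dots> \<le> (1 - t) * max 0 (f x) + t * max 0 (f y)"
    using t by (intro add_mono mult_left_mono) auto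
  finally show "max 0 (f ((1 - t) *\<^sub>R x + t *\<^sub>R y)) \<le> (1 - t) * max 0 (f x) + t * max 0 (f y)"
    using t by simp
qed (rule convex_on_imp_convex[OF assms])

lemma convex_on_sum_functions:
  assumes "finite M" "convex V" "\<And>m. m \<in> M \<Longrightarrow> convex_on V (f m)"
  shows "convex_on V (\<lambda>z. \<Sum>m\<in>M. f m z :: real)"
  using assms by (induction M rule: finite_induct) (auto simp: convex_on_const)

text \<open>
  A segment from \<open>K\<close> to a point far away from \<open>K\<close> crosses the compact set of points at
  distance \<open>e\<close>, where \<open>\<Phi>\<close> has a positive lower bound.
\<close>

lemma infdist_sublevel_tendsto_0:
  fixes \<Phi> :: "'a::euclidean_space \<Rightarrow> real"
  assumes cl: "closed V" and conv: "convex_on V \<Phi>" and cont: "continuous_on V \<Phi>"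
    and L: "L = {z \<in> V. \<Phi> z \<le> 0}" and L_ne: "L \<noteq> {}" and L_bd: "bounded L"
    and xV: "eventually (\<lambda>t. x t \<in> V) F"
    and lim: "\<And>e. e > 0 \<Longrightarrow> eventually (\<lambda>t. \<Phi> (x t) < e) F"
  shows "((\<lambda>t. infdist (x t) L) \<longlongrightarrow> 0) F"
proof -
  have "closed (V \<inter> \<Phi> -` {..0})"
    using cont cl by (intro continuous_closed_preimage) auto
  then have L_cl: "closed L" by (simp add: L vimage_def Int_def)
  have far: "\<exists>m>0. \<forall>z\<in>V. e \<le> infdist z L \<longrightarrow> m \<le> \<Phi> z" if e: "e > 0" for e
  proof -
    define C where "C = V \<inter> (\<lambda>u. infdist u L) -` {e}"
    have "closed C"
      unfolding C_def using cl by (intro continuous_closed_preimage continuous_intros) auto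
    moreover have "bounded C"
    proof -
      obtain R where R: "\<And>z. z \<in> L \<Longrightarrow> norm z \<le> R" using L_bd bounded_iff by blast
      have "norm u \<le> R + e" if "u \<in> C" for u
      proof -
        obtain l where "l \<in> L" "infdist u L = dist u l"
          using infdist_attains_inf[OF L_cl L_ne] by metis
        then show ?thesis
          using that R[of l] norm_triangle_sub[of u l] by (simp add: C_def dist_norm)
      qed
      then show ?thesis by (rule boundedI)
    qed
    ultimately have C: "compact C" by (simp add: compact_eq_bounded_closed)
    have C_pos: "0 < \<Phi> u" if "u \<in> C" for u
    proof (rule ccontr)
      assume "\<not> 0 < \<Phi> u"
      with that have "u \<in> L" by (simp add: L C_def)
      then have "infdist u L = 0" by simp
      with that e show False by (simp add: C_def)
    qed
    obtain m where m: "m > 0" "\<And>u. u \<in> C \<Longrightarrow> m \<le> \<Phi> u"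
    proof (cases "C = {}")
      case True
      then show thesis using that[of 1] by simp
    next
      case False
      moreover have "continuous_on C \<Phi>" using cont by (rule continuous_on_subset) (auto simp: C_def)
      ultimately obtain u where "u \<in> C" "\<And>w. w \<in> C \<Longrightarrow> \<Phi> u \<le> \<Phi> w"
        using continuous_attains_inf[OF C] by blast
      then show thesis using that[of "\<Phi> u"] C_pos by simp
    qed
    have "m \<le> \<Phi> z" if z: "z \<in> V" "e \<le> infdist z L" for z
    proof (rule ccontr)
      assume neg: "\<not> m \<le> \<Phi> z"
      obtain l where l: "l \<in> L" using L_ne by blast
      define h where "h s = (1 - s) *\<^sub>R l + s *\<^sub>R z" for s :: real
      \<comment> \<open>The distance to \<open>L\<close> varies continuously along the segment, from
        0 at \<open>l\<close> to at least \<open>e\<close> at \<open>z\<close>.\<close>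
      have "\<exists>s\<ge>0. s \<le> 1 \<and> infdist (h s) L = e"
        unfolding h_def using l z e by (intro IVT' continuous_intros) auto
      then obtain s where s: "0 \<le> s" "s \<le> 1" "infdist (h s) L = e" by blast
      have hV: "h s \<in> V" using l z(1) s convexD[OF convex_on_imp_convex[OF conv], of l z "1 - s" s]
        by (simp add: L h_def)
      with s have "m \<le> \<Phi> (h s)" by (intro m) (simp add: C_def)
      also have "\<dots> \<le> (1 - s) * \<Phi> l + s * \<Phi> z"
        unfolding h_def using s l z(1) by (intro convex_onD[OF conv]) (auto simp: L)
      also have "\<dots> \<le> s * \<Phi> z"
        using s l by (simp add: L mult_nonneg_nonpos)
      also have "\<dots> < m"
        using s neg m(1) by (smt (verit) mult_left_le_one_le mult_nonneg_nonpos)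
      finally show False by simp
    qed
    with m(1) show ?thesis by blast
  qed
  show ?thesis
  proof (rule tendstoI)
    fix e :: real assume "e > 0"
    from far[OF this] obtain m where m: "m > 0" "\<forall>z\<in>V. e \<le> infdist z L \<longrightarrow> m \<le> \<Phi> z" by blast
    from xV lim[OF m(1)] show "eventually (\<lambda>t. dist (infdist (x t) L) 0 < e) F"
    proof eventually_elim
      case (elim t)
      with m(2) have "\<not> e \<le> infdist (x t) L" by force
      then show ?case by (simp add: infdist_nonneg)
    qed
  qed
qed

section \<open>The Laplacian of an induced subgraph\<close>

text \<open>Self-adjointness. With symmetric edge weights the diagonal part is symmetric in
  \<open>u\<close> and \<open>v\<close>, and exchanging the two summations does the same for the
  mixed part.\<close>

lemma laplacian_sum_by_parts:
  fixes u v :: "'i::finite \<Rightarrow> real"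
  assumes "sym E"
  shows "(\<Sum>i\<in>W. u i * (\<Sum>j\<in>{j. (i, j) \<in> E} \<inter> W. v i - v j)) =
         (\<Sum>i\<in>W. v i * (\<Sum>j\<in>{j. (i, j) \<in> E} \<inter> W. u i - u j))"
proof -
  define e where "e i j = (if (i, j) \<in> E then 1 else 0 :: real)" for i j
  have e: "(\<Sum>j\<in>{j. (i, j) \<in> E} \<inter> W. h j) = (\<Sum>j\<in>W. e i j * h j)" for h :: "'i \<Rightarrow> real" and i
    by (rule sum.mono_neutral_cong_left) (auto simp: e_def)
  have e_sym: "e i j = e j i" for i j using assms by (auto simp: e_def dest: symD)
  have expand: "(\<Sum>i\<in>W. u i * (\<Sum>j\<in>W. e i j * (v i - v j))) =
      (\<Sum>i\<in>W. \<Sum>j\<in>W. e i j * (u i * v i)) - (\<Sum>i\<in>W. \<Sum>j\<in>W. e i j * (u i * v j))"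
    for u v :: "'i \<Rightarrow> real"
    unfolding sum_distrib_left sum_subtractf[symmetric]
    by (intro sum.cong refl) (simp add: algebra_simps)
  have "(\<Sum>i\<in>W. \<Sum>j\<in>W. e i j * (u i * v j)) = (\<Sum>j\<in>W. \<Sum>i\<in>W. e i j * (u i * v j))"
    by (rule sum.swap)
  also have "\<dots> = (\<Sum>j\<in>W. \<Sum>i\<in>W. e j i * (v j * u i))"
    by (intro sum.cong refl) (metis e_sym mult.commute)
  finally show ?thesis
    unfolding e expand by (simp add: mult.commute[of "u _" "v _"])
qed

text \<open>Constants lie in the kernel, so by self-adjointness the range is orthogonal to
  them.\<close>

lemma laplacian_sum_zero:
  fixes v :: "'i::finite \<Rightarrow> real"
  assumes "sym E"
  shows "(\<Sum>i\<in>W. \<Sum>j\<in>{j. (i, j) \<in> E} \<inter> W. v i - v j) = 0"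
  using laplacian_sum_by_parts[OF assms, of "\<lambda>_. 1" v W] by simp

text \<open>The Dirichlet energy, with every edge counted in both directions; hence the factor 2.
  The difference of squares that remains is a Laplacian and sums to zero.\<close>

lemma laplacian_dirichlet:
  fixes v :: "'i::finite \<Rightarrow> real"
  assumes "sym E"
  shows "(\<Sum>i\<in>W. \<Sum>j\<in>{j. (i, j) \<in> E} \<inter> W. (v i - v j)\<^sup>2) =
         2 * (\<Sum>i\<in>W. v i * (\<Sum>j\<in>{j. (i, j) \<in> E} \<inter> W. v i - v j))"
proof -
  have "(\<Sum>i\<in>W. \<Sum>j\<in>{j. (i, j) \<in> E} \<inter> W. (v i - v j)\<^sup>2) =
      (\<Sum>i\<in>W. \<Sum>j\<in>{j. (i, j) \<in> E} \<inter> W. 2 * (v i * (v i - v j)) - ((v i)\<^sup>2 - (v j)\<^sup>2))"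
    by (intro sum.cong refl) (simp add: power2_eq_square algebra_simps)
  also have "\<dots> = 2 * (\<Sum>i\<in>W. v i * (\<Sum>j\<in>{j. (i, j) \<in> E} \<inter> W. v i - v j)) -
      (\<Sum>i\<in>W. \<Sum>j\<in>{j. (i, j) \<in> E} \<inter> W. (v i)\<^sup>2 - (v j)\<^sup>2)"
    unfolding sum_distrib_left sum_subtractf[symmetric] by (rule refl)
  finally show ?thesis using laplacian_sum_zero[OF assms, of "\<lambda>i. (v i)\<^sup>2" W] by simp
qed

text \<open>Zero energy forces equality across every edge, and connectedness propagates it along
  paths.\<close>

lemma laplacian_null_imp_constant:
  fixes v :: "'i::finite \<Rightarrow> real"
  assumes "sym E" "induced_connected W E"
    and null: "(\<Sum>i\<in>W. v i * (\<Sum>j\<in>{j. (i, j) \<in> E} \<inter> W. v i - v j)) = 0"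
    and "k \<in> W" "l \<in> W"
  shows "v k = v l"
proof -
  have "(\<Sum>i\<in>W. \<Sum>j\<in>{j. (i, j) \<in> E} \<inter> W. (v i - v j)\<^sup>2) = 0"
    by (simp add: laplacian_dirichlet[OF assms(1)] null)
  then have edge: "v i = v j" if "(i, j) \<in> E \<inter> W \<times> W" for i j
    using that by (simp add: sum_nonneg_eq_0_iff sum_nonneg)
  have "(k, l) \<in> (E \<inter> W \<times> W)\<^sup>*" using assms by (simp add: induced_connected_def)
  then show ?thesis by (induction rule: rtrancl_induct) (auto simp: edge)
qed

text \<open>
  The Laplacian is self-adjoint, so the component of \<open>s\<close> orthogonal to its range lies in its
  kernel, which consists of constants on \<open>W\<close>, and these are orthogonal to \<open>s\<close>.
\<close>

lemma laplacian_solvable: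
  fixes s :: "'i::finite \<Rightarrow> real"
  assumes E: "sym E" "induced_connected W E" and s: "(\<Sum>i\<in>W. s i) = 0"
  shows "\<exists>v. \<forall>i\<in>W. (\<Sum>j\<in>{j. (i, j) \<in> E} \<inter> W. v i - v j) = s i"
proof -
  define L :: "real ^ 'i \<Rightarrow> real ^ 'i" where
    "L v = (\<chi> i. if i \<in> W then \<Sum>j\<in>{j. (i, j) \<in> E} \<inter> W. v $ i - v $ j else 0)" for v
  have "linear L"
  proof (rule linearI)
    show "L (x + y) = L x + L y" for x y
      by (simp add: L_def vec_eq_iff sum.distrib[symmetric] algebra_simps)
    show "L (r *\<^sub>R x) = r *\<^sub>R L x" for r x
      by (simp add: L_def vec_eq_iff sum_distrib_left right_diff_distrib)
  qed
  then have span: "span (range L) = range L"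
    by (simp add: linear_subspace_image span_eq_iff)
  have inner_W: "x \<bullet> (\<chi> i. if i \<in> W then h i else 0) = (\<Sum>i\<in>W. x $ i * h i)"
    for x :: "real ^ 'i" and h
    by (simp add: inner_vec_def if_distrib[of "(*) _"] sum.If_cases)
  define t :: "real ^ 'i" where "t = (\<chi> i. if i \<in> W then s i else 0)"
  obtain r z where rz: "r \<in> span (range L)" "\<And>w. w \<in> span (range L) \<Longrightarrow> orthogonal z w" "t = r + z"
    using orthogonal_subspace_decomp_exists by blast
  have "z \<bullet> L z = 0" using rz(2)[of "L z"] by (simp add: span orthogonal_def)
  then have "(\<Sum>i\<in>W. z $ i * (\<Sum>j\<in>{j. (i, j) \<in> E} \<inter> W. z $ i - z $ j)) = 0"
    by (simp add: L_def inner_W)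
  then have const: "z $ k = z $ l" if "k \<in> W" "l \<in> W" for k l
    using that by (rule laplacian_null_imp_constant[OF E])
  have "z \<bullet> t = 0"
  proof (cases "W = {}")
    case False
    then obtain k where k: "k \<in> W" by blast
    have "z \<bullet> t = (\<Sum>i\<in>W. z $ k * s i)"
      unfolding t_def inner_W by (intro sum.cong refl) (simp add: const[OF _ k])
    then show ?thesis using s by (simp flip: sum_distrib_left)
  qed (simp add: t_def inner_vec_def)
  moreover have "z \<bullet> r = 0" using rz by (simp add: orthogonal_def)
  ultimately have "z = 0" using rz(3) by (simp add: inner_right_distrib)
  with rz have "t \<in> range L" by (simp add: span)
  then obtain v where "L v = t" by auto
  then have "(\<Sum>j\<in>{j. (i, j) \<in> E} \<inter> W. v $ i - v $ j) = s i" if "i \<in> W" for i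
    using that by (auto simp: L_def t_def vec_eq_iff split: if_splits)
  then show ?thesis by (intro exI[of _ "\<lambda>i. v $ i"]) simp
qed

section \<open>Subgradient flows\<close>

lemma has_vector_derivative_at_left:
  fixes \<delta> :: "real \<Rightarrow> 'a::real_normed_vector"
  assumes "(\<delta> has_vector_derivative D) (at t within {A..})" "A < t" "e > 0"
  shows "eventually (\<lambda>s. norm (\<delta> t - \<delta> s - (t - s) *\<^sub>R D) \<le> e * (t - s)) (at_left t)"
proof -
  obtain d where d: "d > 0" "\<forall>s\<in>{A..}. norm (s - t) < d \<longrightarrow>
      norm (\<delta> s - \<delta> t - (s - t) *\<^sub>R D) \<le> e * norm (s - t)"
    using assms(1,3) unfolding has_vector_derivative_def has_derivative_within_alt by blast
  have "eventually (\<lambda>s. s \<in> {max A (t - d)<..<t}) (at_left t)"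
    using assms(2) d(1) by (intro eventually_at_left_real) auto
  then show ?thesis
  proof eventually_elim
    case (elim s)
    then have "s \<in> {A..}" "norm (s - t) < d" by auto
    with d(2) have "norm (\<delta> s - \<delta> t - (s - t) *\<^sub>R D) \<le> e * norm (s - t)" by blast
    moreover have "\<delta> s - \<delta> t - (s - t) *\<^sub>R D = - (\<delta> t - \<delta> s - (t - s) *\<^sub>R D)"
      by (simp add: algebra_simps)
    ultimately have "norm (\<delta> t - \<delta> s - (t - s) *\<^sub>R D) \<le> e * norm (s - t)"
      by (metis norm_minus_cancel)
    then show ?case using elim by simp
  qed
qed

lemma norm_sq_at_left:
  fixes \<delta> :: "real \<Rightarrow> 'a::real_inner"
  assumes D: "(\<delta> has_vector_derivative D) (at t within {A..})" "A < t" and e: "e > 0"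
  shows "eventually (\<lambda>s. (norm (\<delta> t))\<^sup>2 - (norm (\<delta> s))\<^sup>2 \<le> 2 * (t - s) * (\<delta> t \<bullet> D) + e * (t - s)) (at_left t)"
proof -
  \<comment> \<open>Chosen so that the remainder, paired with \<open>2 * norm (\<delta> t)\<close>,
    costs at most \<open>e * (t - s)\<close>; the added 1 keeps the denominator positive.\<close>
  define r where "r = e / (2 * (norm (\<delta> t) + 1))"
  have n1: "norm (\<delta> t) + 1 > 0" using norm_ge_zero[of "\<delta> t"] by linarith
  then have r: "r > 0" using e by (simp add: r_def)
  have rn: "2 * norm (\<delta> t) * r \<le> e"
    using n1 e by (simp add: r_def field_simps)
  from has_vector_derivative_at_left[OF D r] eventually_at_left_real[OF D(2)]
  show ?thesis
  proof eventually_elim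
    case (elim s)
    define q where "q = \<delta> t - \<delta> s - (t - s) *\<^sub>R D"
    define u where "u = q + (t - s) *\<^sub>R D"
    have sq: "(norm (x - z))\<^sup>2 = (norm x)\<^sup>2 + (norm z)\<^sup>2 - 2 * (x \<bullet> z)" for x z :: 'a
      by (simp add: power2_norm_eq_inner inner_diff_left inner_diff_right inner_commute)
    have s_eq: "\<delta> s = \<delta> t - u" by (simp add: q_def u_def)
    \<comment> \<open>Expanding the square leaves \<open>- (norm u)\<^sup>2\<close>, which is
      dropped; only an upper bound is wanted.\<close>
    have "(norm (\<delta> t))\<^sup>2 - (norm (\<delta> s))\<^sup>2 \<le> 2 * (\<delta> t \<bullet> u)"
      unfolding s_eq sq by simp
    also have "\<dots> = 2 * (t - s) * (\<delta> t \<bullet> D) + 2 * (\<delta> t \<bullet> q)"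
      by (simp add: u_def inner_right_distrib)
    also have "2 * (\<delta> t \<bullet> q) \<le> 2 * (norm (\<delta> t) * norm q)"
      using norm_cauchy_schwarz[of "\<delta> t" q] by simp
    also have "\<dots> \<le> 2 * (norm (\<delta> t) * (r * (t - s)))"
      using elim(1) by (intro mult_left_mono) (simp_all add: q_def)
    also have "\<dots> \<le> e * (t - s)"
      using mult_right_mono[OF rn, of "t - s"] elim(2) by (simp add: mult_ac)
    finally show ?case by simp
  qed
qed

text \<open>The squared norm has derivative \<open>2 * (\<delta> t \<bullet> D t)\<close> almost
  everywhere, which is nonpositive. Applied to the difference of two solutions and to the
  displacement from a minimizer.\<close>

lemma norm_nonincreasing:
  fixes \<delta> :: "real \<Rightarrow> 'a::euclidean_space"
  assumes ac: "\<And>T. T \<ge> 0 \<Longrightarrow> abs_continuous_on {0..T} \<delta>"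
    and ae: "AE t in lebesgue. t \<ge> 0 \<longrightarrow> (\<delta> has_vector_derivative D t) (at t within {0..})"
    and D: "\<And>t. \<delta> t \<bullet> D t \<le> 0"
    and st: "0 \<le> s" "s \<le> t"
  shows "norm (\<delta> t) \<le> norm (\<delta> s)"
proof -
  have "(norm (\<delta> t))\<^sup>2 \<le> (norm (\<delta> s))\<^sup>2"
  proof (rule abs_continuous_left_dini_nonincreasing[OF st(2)])
    show "abs_continuous_on {s..t} (\<lambda>t. (norm (\<delta> t))\<^sup>2)"
      by (rule abs_continuous_on_norm_sq, rule abs_continuous_on_subset[OF ac[of t]]) (use st in auto)
    show "AE r in lebesgue. r \<in> {s<..t} \<longrightarrow>
        (\<forall>e>0. \<forall>\<^sub>F q in at_left r. (norm (\<delta> r))\<^sup>2 - (norm (\<delta> q))\<^sup>2 \<le> e * (r - q))"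
      using ae
    proof eventually_elim
      case (elim r)
      show ?case
      proof (intro impI allI)
        fix e :: real assume r: "r \<in> {s<..t}" and e: "e > 0"
        then have r0: "0 < r" using st by auto
        with elim have "(\<delta> has_vector_derivative D r) (at r within {0..})" by simp
        from norm_sq_at_left[OF this r0 e] eventually_at_left_real[OF r0]
        show "\<forall>\<^sub>F q in at_left r. (norm (\<delta> r))\<^sup>2 - (norm (\<delta> q))\<^sup>2 \<le> e * (r - q)"
        proof eventually_elim
          case (elim q)
          have "2 * (r - q) * (\<delta> r \<bullet> D r) \<le> 0"
            using elim(2) D[of r] by (intro mult_nonneg_nonpos) auto
          with elim(1) show ?case by linarith
        qed
      qed
    qed
  qed
  then show ?thesis by (rule power2_le_imp_le) simp
qed

text \<open>\<open>g\<close> picks an arbitrary subgradient at each point, with no regularity in the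
  point. Having one everywhere makes \<open>p\<close> convex.\<close>

locale subgradient_selection =
  fixes p :: "'a::euclidean_space \<Rightarrow> real" and g :: "'a \<Rightarrow> 'a"
  assumes subgradient: "p v + g v \<bullet> (w - v) \<le> p w"
begin

lemma monotone: "(v - w) \<bullet> (g v - g w) \<ge> 0"
  using subgradient[of v w] subgradient[of w v] by (simp add: inner_diff algebra_simps inner_commute)

lemma continuous: "continuous_on UNIV p"
proof -
  have "convex_on UNIV p"
  proof (rule convex_onI)
    fix t :: real and x y :: 'a assume t: "0 < t" "t < 1"
    define m where "m = (1 - t) *\<^sub>R x + t *\<^sub>R y"
    \<comment> \<open>Both inequalities use the subgradient at the intermediate point
      \<open>m\<close>; in the weighted sum its linear terms cancel.\<close>
    have "(1 - t) * (p m + g m \<bullet> (x - m)) + t * (p m + g m \<bullet> (y - m)) \<le> (1 - t) * p x + t * p y"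
      using t by (intro add_mono mult_left_mono subgradient) auto
    moreover have "(1 - t) * (p m + g m \<bullet> (x - m)) + t * (p m + g m \<bullet> (y - m)) =
        p m + g m \<bullet> ((1 - t) *\<^sub>R x + t *\<^sub>R y - m)"
      by (simp add: inner_diff_right inner_add_right algebra_simps)
    ultimately show "p ((1 - t) *\<^sub>R x + t *\<^sub>R y) \<le> (1 - t) * p x + t * p y"
      by (simp add: m_def)
  qed simp
  then show ?thesis by (intro convex_on_continuous) auto
qed

text \<open>Subgradients are bounded on bounded sets, and a bound on the subgradients is a Lipschitz
  constant. It makes \<open>p\<close> along a solution absolutely continuous.\<close>

lemma lipschitz_on_bounded:
  assumes "bounded S"
  obtains L where "\<And>u v. u \<in> S \<Longrightarrow> v \<in> S \<Longrightarrow> \<bar>p u - p v\<bar> \<le> L * dist u v"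
proof -
  obtain R where R: "\<And>v. v \<in> S \<Longrightarrow> norm v \<le> R" using assms bounded_iff by blast
  have "compact (p ` cball 0 (R + 1))"
    using continuous_on_subset[OF continuous] by (intro compact_continuous_image) auto
  then have "bounded (p ` cball 0 (R + 1))" by (rule compact_imp_bounded)
  then obtain B where "\<forall>x\<in>p ` cball 0 (R + 1). norm x \<le> B"
    unfolding bounded_iff by (rule exE)
  then have B: "\<bar>p v\<bar> \<le> B" if "norm v \<le> R + 1" for v using that by auto
  have g_le: "norm (g v) \<le> 2 * B" if v: "v \<in> S" for v
  proof -
    \<comment> \<open>Testing with a unit step in the direction of \<open>g v\<close> isolates its
      norm; the radius \<open>R + 1\<close> leaves room for this step.\<close>
    have "p v + g v \<bullet> (v + sgn (g v) - v) \<le> p (v + sgn (g v))" by (rule subgradient)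
    moreover have "g v \<bullet> sgn (g v) = norm (g v)"
      by (cases "g v = 0") (simp_all add: sgn_div_norm dot_square_norm power2_eq_square)
    moreover have "norm (v + sgn (g v)) \<le> R + 1"
      using R[OF v] norm_triangle_ineq[of v "sgn (g v)"] by (simp add: norm_sgn split: if_splits)
    ultimately show ?thesis using B[of v] B[of "v + sgn (g v)"] R[OF v] by simp
  qed
  have one: "p u - p v \<le> 2 * B * dist u v" if "u \<in> S" for u v
  proof -
    have "p u - p v \<le> g u \<bullet> (u - v)" using subgradient[of u v] by (simp add: inner_diff_right)
    also have "\<dots> \<le> norm (g u) * norm (u - v)" by (rule norm_cauchy_schwarz)
    also have "\<dots> \<le> 2 * B * dist u v"
      using g_le[OF that] by (simp add: dist_norm mult_right_mono)
    finally show ?thesis .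
  qed
  show thesis
  proof (rule that[of "2 * B"])
    fix u v assume "u \<in> S" "v \<in> S"
    then show "\<bar>p u - p v\<bar> \<le> 2 * B * dist u v"
      using one[of u v] one[of v u] by (simp add: dist_commute)
  qed
qed

end

section \<open>Uniqueness, descent and convergence of the flow\<close>

locale subgradient_flow = subgradient_selection p g
  for p :: "'a::euclidean_space \<Rightarrow> real" and g +
  fixes k :: real and y :: "real \<Rightarrow> 'a"
  assumes k_pos: "k > 0" and solution: "caratheodory_solution (\<lambda>v. - k *\<^sub>R g v) y"
begin

lemma ac: "T \<ge> 0 \<Longrightarrow> abs_continuous_on {0..T} y"
  and ae: "AE t in lebesgue. t \<ge> 0 \<longrightarrow> (y has_vector_derivative - k *\<^sub>R g (y t)) (at t within {0..})"
  using solution by (auto simp: caratheodory_solution_def)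

text \<open>Monotonicity of the subdifferential makes the distance between two solutions
  nonincreasing, and it starts at zero.\<close>

lemma unique:
  assumes "caratheodory_solution (\<lambda>v. - k *\<^sub>R g v) w" "w 0 = y 0" "t \<ge> 0"
  shows "w t = y t"
proof -
  interpret w: subgradient_flow p g k w
    using k_pos assms(1) by unfold_locales
  have "norm (w t - y t) \<le> norm (w 0 - y 0)"
  proof (rule norm_nonincreasing[where D = "\<lambda>t. - k *\<^sub>R g (w t) - - k *\<^sub>R g (y t)"])
    show "abs_continuous_on {0..T} (\<lambda>t. w t - y t)" if "T \<ge> 0" for T
    proof (rule abs_continuous_on_dist_le[OF w.ac[OF that] ac[OF that], where L = 1])
      fix u v
      have "w u - y u - (w v - y v) = (w u - w v) - (y u - y v)" by simp
      then show "dist (w u - y u) (w v - y v) \<le> 1 * (dist (w u) (w v) + dist (y u) (y v))"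
        unfolding dist_norm by (metis mult_1 norm_triangle_ineq4)
    qed
    show "AE t in lebesgue. 0 \<le> t \<longrightarrow> ((\<lambda>t. w t - y t) has_vector_derivative
        - k *\<^sub>R g (w t) - - k *\<^sub>R g (y t)) (at t within {0..})"
      using w.ae ae by eventually_elim (blast intro: has_vector_derivative_diff)
    show "(w t - y t) \<bullet> (- k *\<^sub>R g (w t) - - k *\<^sub>R g (y t)) \<le> 0" for t
      using mult_nonneg_nonneg[OF less_imp_le[OF k_pos] monotone[of "w t" "y t"]]
      by (simp add: inner_diff algebra_simps)
  qed (use assms in auto)
  with assms(2) show ?thesis by simp
qed

text \<open>At every point the negative subgradient makes no obtuse angle with the direction towards
  a minimizer \<open>z\<close>.\<close>

lemma fejer:
  assumes "\<And>v. p z \<le> p v" "0 \<le> s" "s \<le> t"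
  shows "norm (y t - z) \<le> norm (y s - z)"
proof (rule norm_nonincreasing[where D = "\<lambda>t. - k *\<^sub>R g (y t)"])
  show "abs_continuous_on {0..T} (\<lambda>t. y t - z)" if "T \<ge> 0" for T
    by (rule abs_continuous_on_dist_le[OF ac[OF that] ac[OF that], where L = 1])
      (simp add: dist_norm)
  show "AE t in lebesgue. 0 \<le> t \<longrightarrow> ((\<lambda>t. y t - z) has_vector_derivative
      - k *\<^sub>R g (y t)) (at t within {0..})"
    using ae by eventually_elim (auto simp: has_vector_derivative_diff_const)
  show "(y t - z) \<bullet> (- k *\<^sub>R g (y t)) \<le> 0" for t
  proof -
    have "g (y t) \<bullet> (y t - z) \<ge> 0"
      using subgradient[of "y t" z] assms(1)[of "y t"] by (simp add: inner_diff_right)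
    then show ?thesis using k_pos by (simp add: inner_commute)
  qed
qed fact+

text \<open>\<open>p\<close> need not be differentiable, so no chain rule is used. The subgradient
  at the current point bounds the increment from the left by \<open>- k * (r - q)\<close> times the
  squared norm of that subgradient, up to a small remainder.\<close>

lemma descent:
  assumes "0 \<le> s" "s \<le> t"
  shows "p (y t) \<le> p (y s)"
proof (rule abs_continuous_left_dini_nonincreasing[OF assms(2)])
  have y_ac: "abs_continuous_on {s..t} y"
    by (rule abs_continuous_on_subset[OF ac[of t]]) (use assms in auto)
  have "compact (y ` {s..t})"
    using abs_continuous_on_imp_continuous_on[OF y_ac] by (intro compact_continuous_image) auto
  then obtain L where L: "\<And>u v. u \<in> y ` {s..t} \<Longrightarrow> v \<in> y ` {s..t} \<Longrightarrow> \<bar>p u - p v\<bar> \<le> L * dist u v"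
    using lipschitz_on_bounded compact_imp_bounded by metis
  show "abs_continuous_on {s..t} (\<lambda>t. p (y t))"
  proof (rule abs_continuous_on_dist_le[OF y_ac y_ac])
    fix u v assume "u \<in> {s..t}" "v \<in> {s..t}"
    then have "\<bar>p (y u) - p (y v)\<bar> \<le> L * dist (y u) (y v)" by (intro L) auto
    then show "dist (p (y u)) (p (y v)) \<le> L / 2 * (dist (y u) (y v) + dist (y u) (y v))"
      by (simp add: dist_real_def)
  qed
  show "AE r in lebesgue. r \<in> {s<..t} \<longrightarrow>
      (\<forall>e>0. \<forall>\<^sub>F q in at_left r. p (y r) - p (y q) \<le> e * (r - q))"
    using ae
  proof eventually_elim
    case (elim r)
    show ?case
    proof (intro impI allI)
      fix e :: real assume r: "r \<in> {s<..t}" and e: "e > 0"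
      then have r0: "0 < r" using assms by auto
      with elim have D: "(y has_vector_derivative - k *\<^sub>R g (y r)) (at r within {0..})" by simp
      define G where "G = norm (g (y r)) + 1"
      have G: "G > 0" "norm (g (y r)) \<le> G" by (simp_all add: G_def add_nonneg_pos)
      then have "e / G > 0" using e by simp
      from has_vector_derivative_at_left[OF D r0 this] eventually_at_left_real[OF r0]
      show "\<forall>\<^sub>F q in at_left r. p (y r) - p (y q) \<le> e * (r - q)"
      proof eventually_elim
        case (elim q)
        define \<rho> where "\<rho> = y r - y q - (r - q) *\<^sub>R (- k *\<^sub>R g (y r))"
        have "p (y r) - p (y q) \<le> g (y r) \<bullet> (y r - y q)"
          using subgradient[of "y r" "y q"] by (simp add: inner_diff_right)
        also have "\<dots> = g (y r) \<bullet> \<rho> - (r - q) * (k * (g (y r) \<bullet> g (y r)))"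
          by (simp add: \<rho>_def inner_diff_right inner_add_right)
        also have "\<dots> \<le> g (y r) \<bullet> \<rho>"
          using k_pos elim(2) by simp
        also have "\<dots> \<le> norm (g (y r)) * norm \<rho>" by (rule norm_cauchy_schwarz)
        also have "\<dots> \<le> G * (e / G * (r - q))"
          using elim(1) G by (intro mult_mono) (auto simp: \<rho>_def)
        also have "\<dots> = e * (r - q)" using G by simp
        finally show ?case .
      qed
    qed
  qed
qed

text \<open>The squared distance to \<open>z\<close> decreases at rate at least
  \<open>2 * k * (p (y t) - p z)\<close>, which by descent is at least the constant \<open>c\<close>
  up to time \<open>T\<close>. Hence adding \<open>c * t\<close> still gives a nonincreasing
  function. The point \<open>z\<close> is arbitrary.\<close>

lemma rate:
  assumes T: "0 \<le> T"
  shows "2 * k * T * (p (y T) - p z) \<le> (norm (y 0 - z))\<^sup>2"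
proof -
  define c where "c = 2 * k * (p (y T) - p z)"
  have "(norm (y T - z))\<^sup>2 + c * T \<le> (norm (y 0 - z))\<^sup>2 + c * 0"
  proof (rule abs_continuous_left_dini_nonincreasing[OF T])
    have "abs_continuous_on {0..T} (\<lambda>t. y t - z)"
      by (rule abs_continuous_on_dist_le[OF ac[OF T] ac[OF T], where L = 1]) (simp add: dist_norm)
    then have sq: "abs_continuous_on {0..T} (\<lambda>t. (norm (y t - z))\<^sup>2)" by (rule abs_continuous_on_norm_sq)
    show "abs_continuous_on {0..T} (\<lambda>t. (norm (y t - z))\<^sup>2 + c * t)"
    proof (rule abs_continuous_on_dist_le[OF sq abs_continuous_on_ident, where L = "1 + \<bar>c\<bar>"])
      fix u v :: real
      define a b where "a = (norm (y u - z))\<^sup>2" and "b = (norm (y v - z))\<^sup>2"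
      have "\<bar>a + c * u - (b + c * v)\<bar> \<le> \<bar>a - b\<bar> + \<bar>c * (u - v)\<bar>" by (simp add: algebra_simps)
      also have "\<dots> \<le> (1 + \<bar>c\<bar>) * (\<bar>a - b\<bar> + \<bar>u - v\<bar>)"
        unfolding abs_mult distrib_left distrib_right by simp
      finally show "dist (a + c * u) (b + c * v) \<le> (1 + \<bar>c\<bar>) * (dist a b + dist u v)"
        by (simp add: dist_real_def)
    qed
    show "AE t in lebesgue. t \<in> {0<..T} \<longrightarrow> (\<forall>e>0. \<forall>\<^sub>F s in at_left t.
        (norm (y t - z))\<^sup>2 + c * t - ((norm (y s - z))\<^sup>2 + c * s) \<le> e * (t - s))"
      using ae
    proof eventually_elim
      case (elim t)
      show ?case
      proof (intro impI allI)
        fix e :: real assume t: "t \<in> {0<..T}" and e: "e > 0"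
        then have t0: "0 < t" by auto
        with elim have "((\<lambda>t. y t - z) has_vector_derivative - k *\<^sub>R g (y t)) (at t within {0..})"
          by (simp add: has_vector_derivative_diff_const)
        from norm_sq_at_left[OF this t0 e] eventually_at_left_real[OF t0]
        show "\<forall>\<^sub>F s in at_left t.
            (norm (y t - z))\<^sup>2 + c * t - ((norm (y s - z))\<^sup>2 + c * s) \<le> e * (t - s)"
        proof eventually_elim
          case (elim s)
          have "p (y T) - p z \<le> g (y t) \<bullet> (y t - z)"
            using subgradient[of "y t" z] descent[of t T] t by (simp add: inner_diff_right)
          then have "2 * (t - s) * (k * (p (y T) - p z)) \<le> 2 * (t - s) * (k * (g (y t) \<bullet> (y t - z)))"
            using elim(2) k_pos by (intro mult_left_mono) auto
          moreover have "c * (t - s) = 2 * (t - s) * (k * (p (y T) - p z))"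
            unfolding c_def by (simp only: mult_ac)
          moreover have "(y t - z) \<bullet> (- k *\<^sub>R g (y t)) = - (k * (g (y t) \<bullet> (y t - z)))"
            by (simp add: inner_commute)
          ultimately have "c * (t - s) \<le> - (2 * (t - s) * ((y t - z) \<bullet> (- k *\<^sub>R g (y t))))"
            by (simp only: mult_minus_right minus_minus)
          with elim(1) show ?case by (simp add: algebra_simps)
        qed
      qed
    qed
  qed
  then have "c * T \<le> (norm (y 0 - z))\<^sup>2" by (smt (verit) mult_zero_right zero_le_power2)
  then show ?thesis by (simp add: c_def mult_ac)
qed

lemma value_tendsto_inf:
  assumes lb: "\<And>v. r \<le> p v" and inf: "\<And>e. e > 0 \<Longrightarrow> \<exists>v. p v < r + e"
  shows "((\<lambda>t. p (y t)) \<longlongrightarrow> r) at_top"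
proof (rule tendstoI)
  fix e :: real assume e: "e > 0"
  obtain z where z: "p z < r + e / 2" using inf[of "e / 2"] e by auto
  \<comment> \<open>Beyond this time the rate bound leaves less than \<open>e / 2\<close> between
    \<open>p (y t)\<close> and \<open>p z\<close>; \<open>z\<close> itself is within
    \<open>e / 2\<close> of the infimum, which need not be attained.\<close>
  define T where "T = (norm (y 0 - z))\<^sup>2 / (k * e) + 1"
  have ke: "k * e > 0" using e k_pos by simp
  show "eventually (\<lambda>t. dist (p (y t)) r < e) at_top"
    using eventually_ge_at_top[of T]
  proof eventually_elim
    case (elim t)
    have "(norm (y 0 - z))\<^sup>2 < T * (k * e)" using e k_pos by (simp add: T_def distrib_right)
    also have "\<dots> \<le> t * (k * e)" using elim ke by (intro mult_right_mono) auto
    finally have lt: "(norm (y 0 - z))\<^sup>2 < t * (k * e)" .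
    have "T > 0" using ke by (simp add: T_def add_nonneg_pos)
    with elim have t: "t > 0" by simp
    then have "2 * k * t * (p (y t) - p z) < 2 * k * t * (e / 2)"
      using rate[of t z] lt by (simp add: mult_ac)
    then have "p (y t) - p z < e / 2" using t k_pos by simp
    with z lb[of "y t"] show ?case by (simp add: dist_real_def)
  qed
qed

text \<open>The trajectory stays in a ball and so has a cluster point \<open>l\<close>, at which
  \<open>p\<close> takes its minimum by continuity. Distances to \<open>l\<close> are then
  nonincreasing too, so closeness at one time persists.\<close>

lemma converges_to_minimizer:
  assumes z: "\<And>v. p z \<le> p v"
  obtains l where "\<And>v. p l \<le> p v" "(y \<longlongrightarrow> l) at_top"
proof -
  have lim: "((\<lambda>t. p (y t)) \<longlongrightarrow> p z) at_top"
    by (rule value_tendsto_inf[OF z]) (auto intro: exI[of _ z])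
  have "y (real n) \<in> cball z (norm (y 0 - z))" for n
    using fejer[OF z, of 0 "real n"] by (simp add: dist_norm norm_minus_commute)
  then obtain l q where q: "strict_mono q" "((\<lambda>n. y (real n)) \<circ> q) \<longlonglongrightarrow> l"
    using compact_cball[of z "norm (y 0 - z)"] unfolding compact_def by meson
  have q_top: "filterlim (\<lambda>n. real (q n)) at_top sequentially"
    by (rule filterlim_compose[OF filterlim_real_sequentially filterlim_subseq[OF q(1)]])
  have "(\<lambda>n. p (y (real (q n)))) \<longlonglongrightarrow> p z"
    by (rule filterlim_compose[OF lim q_top])
  moreover have "(\<lambda>n. p (y (real (q n)))) \<longlonglongrightarrow> p l"
    using continuous_on_tendsto_compose[OF continuous q(2)] by (simp add: o_def)
  ultimately have "p l = p z" by (rule LIMSEQ_unique[rotated])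
  then have l: "p l \<le> p v" for v using z by simp
  have "(y \<longlongrightarrow> l) at_top"
  proof (rule tendstoI)
    fix e :: real assume "e > 0"
    then have "eventually (\<lambda>n. dist (y (real (q n))) l < e) sequentially"
      using tendstoD[OF q(2)] by (simp add: o_def)
    then obtain n where n: "dist (y (real (q n))) l < e" by (auto simp: eventually_sequentially)
    show "eventually (\<lambda>t. dist (y t) l < e) at_top"
      using eventually_ge_at_top[of "real (q n)"]
    proof eventually_elim
      case (elim t)
      then show ?case using fejer[OF l, of "real (q n)" t] n by (simp add: dist_norm)
    qed
  qed
  with l show thesis by (rule that)
qed

end

section \<open>The value functions of the local problems\<close>

lemma infdist_lessE:
  assumes "infdist x A < e" "A \<noteq> {}"
  obtains a where "a \<in> A" "dist x a < e"
proof -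
  have "(INF a\<in>A. dist x a) < e" using assms by (simp add: infdist_def)
  then show thesis
    using that assms(2) by (subst (asm) cINF_less_iff) (auto intro: bdd_belowI2[where m = 0])
qed

lemma dist_vec_le_sum: "dist x y \<le> (\<Sum>i\<in>UNIV. dist (x $ i) (y $ i))"
  unfolding dist_vec_def by (rule L2_set_le_sum) simp

text \<open>The multiplier condition holds at every \<open>v\<close>, not only along a trajectory:
  convexity and continuity of the value functions rest on subgradients at all points.\<close>

locale sparse_problem =
  fixes V :: "'i::finite \<Rightarrow> 'v::euclidean_space set"
    and f :: "'i \<Rightarrow> 'v \<Rightarrow> real"
    and a :: "'i \<Rightarrow> 'm::finite \<Rightarrow> 'v"
    and b :: "'i \<Rightarrow> 'm \<Rightarrow> real"
    and E :: "('i \<times> 'i) set"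
    and c :: "(real ^ 'm) ^ 'i \<Rightarrow> (real ^ 'm) ^ 'i"
  assumes subspace: "subspace (V i)"
    and sym: "sym E"
    and convex: "convex_on (V i) (f i)"
    and finite_value: "\<bar>P_value V f a b\<bar> \<noteq> \<infinity>"
    and feasible: "SL_feasible V a b E v i \<noteq> {}"
    and connected: "induced_connected (active_agents a b m) E"
    and multiplier: "SL_multiplier V f a b E v i (c v $ i)"
begin

section \<open>Coupling constraints and local constraints\<close>

abbreviation nb :: "'i \<Rightarrow> 'm \<Rightarrow> 'i set" where
  "nb i m \<equiv> {j. (i, j) \<in> E} \<inter> active_agents a b m"

definition lap :: "(real ^ 'm) ^ 'i \<Rightarrow> 'i \<Rightarrow> 'm \<Rightarrow> real" where
  "lap v i m = (\<Sum>j\<in>nb i m. v $ i $ m - v $ j $ m)"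

lemma local_constraint_eq: "local_constraint a b E v i m z = a i m \<bullet> z + lap v i m + b i m"
  by (simp add: local_constraint_def active_neighbors_def lap_def)

lemma active_iff: "m \<in> active_constraints a b i \<longleftrightarrow> i \<in> active_agents a b m"
  by (simp add: active_constraints_def active_agents_def)

lemma active_constraints_eq: "active_constraints a b i = {m. i \<in> active_agents a b m}"
  using active_iff by blast

lemma linear_lap: "linear (\<lambda>v. lap v i m)"
  by (rule linearI) (simp_all add: lap_def sum.distrib[symmetric] sum_distrib_left algebra_simps)

lemma lap_sum_zero: "(\<Sum>i\<in>active_agents a b m. lap v i m) = 0"
  unfolding lap_def by (rule laplacian_sum_zero[OF sym])

text \<open>Inactive agents contribute nothing, and the Laplacian terms of the active ones cancel
  for every \<open>v\<close>.\<close>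

lemma coupling_eq:
  "(\<Sum>i\<in>UNIV. a i m \<bullet> x $ i + b i m) =
    (\<Sum>i\<in>active_agents a b m. local_constraint a b E v i m (x $ i))"
proof -
  have "(\<Sum>i\<in>UNIV. a i m \<bullet> x $ i + b i m) = (\<Sum>i\<in>active_agents a b m. a i m \<bullet> x $ i + b i m)"
    by (rule sum.mono_neutral_right) (auto simp: active_agents_def)
  also have "\<dots> = (\<Sum>i\<in>active_agents a b m. a i m \<bullet> x $ i + b i m) + (\<Sum>i\<in>active_agents a b m. lap v i m)"
    by (simp add: lap_sum_zero)
  also have "\<dots> = (\<Sum>i\<in>active_agents a b m. local_constraint a b E v i m (x $ i))"
    unfolding sum.distrib[symmetric] local_constraint_eq by (intro sum.cong refl) simp
  finally show ?thesis .
qed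

lemma local_feasible_imp_feasible:
  assumes "\<And>i. x $ i \<in> SL_feasible V a b E v i"
  shows "x \<in> P_feasible V a b"
proof -
  have "(\<Sum>i\<in>active_agents a b m. local_constraint a b E v i m (x $ i)) \<le> 0" for m
    using assms by (intro sum_nonpos) (auto simp: SL_feasible_def active_iff)
  then show ?thesis
    using assms by (simp add: P_feasible_def SL_feasible_def coupling_eq[of _ _ v])
qed

text \<open>For each constraint the total slack is spread evenly: every active agent receives the
  nonpositive average, and the deviations from it sum to zero, so a Laplacian realizes them.\<close>

lemma feasible_imp_local_feasible:
  assumes x: "x \<in> P_feasible V a b"
  shows "\<exists>v. \<forall>i. x $ i \<in> SL_feasible V a b E v i"
proof -
  have "\<exists>u. \<forall>i\<in>active_agents a b m. a i m \<bullet> x $ i + b i m + (\<Sum>j\<in>nb i m. u i - u j) \<le> 0" for m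
  proof -
    let ?W = "active_agents a b m"
    define s where "s i = a i m \<bullet> x $ i + b i m" for i
    \<comment> \<open>With no active agent this is \<open>0 / 0\<close>, that is 0, and the claim
      about active agents is vacuous.\<close>
    define \<mu> where "\<mu> = (\<Sum>i\<in>?W. s i) / card ?W"
    have "(\<Sum>i\<in>?W. s i) = (\<Sum>i\<in>UNIV. s i)"
      by (rule sum.mono_neutral_left) (auto simp: s_def active_agents_def)
    then have "(\<Sum>i\<in>?W. s i) \<le> 0" using x by (simp add: P_feasible_def s_def)
    then have mu: "\<mu> \<le> 0" unfolding \<mu>_def by (simp add: divide_nonpos_nonneg)
    have "(\<Sum>i\<in>?W. \<mu> - s i) = 0"
      by (cases "?W = {}") (simp_all add: sum_subtractf \<mu>_def)
    then obtain u where "\<forall>i\<in>?W. (\<Sum>j\<in>nb i m. u i - u j) = \<mu> - s i"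
      using laplacian_solvable[OF sym connected] by blast
    with mu show ?thesis by (intro exI[of _ u]) (simp add: s_def)
  qed
  then obtain u where u: "\<And>m i. i \<in> active_agents a b m \<Longrightarrow>
      a i m \<bullet> x $ i + b i m + (\<Sum>j\<in>nb i m. u m i - u m j) \<le> 0"
    by metis
  show ?thesis
  proof (intro exI[of _ "\<chi> i m. u m i"] allI)
    fix i
    show "x $ i \<in> SL_feasible V a b E (\<chi> i m. u m i) i"
      using x u by (auto simp: SL_feasible_def P_feasible_def local_constraint_eq lap_def active_iff algebra_simps)
  qed
qed

section \<open>The optimal value of (P)\<close>

definition opt :: real where
  "opt = real_of_ereal (P_value V f a b)"

lemma P_value_eq: "P_value V f a b = ereal opt"
  using finite_value by (simp add: opt_def ereal_real)

lemma opt_le: "x \<in> P_feasible V a b \<Longrightarrow> opt \<le> total_cost f x"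
  using INF_lower[of x "P_feasible V a b" "\<lambda>x. ereal (total_cost f x)"] P_value_eq
  by (simp add: P_value_def)

lemma opt_approx:
  assumes "e > 0"
  obtains x where "x \<in> P_feasible V a b" "total_cost f x < opt + e"
proof -
  have "(INF x \<in> P_feasible V a b. ereal (total_cost f x)) < ereal (opt + e)"
    using P_value_eq assms by (simp add: P_value_def)
  then obtain x where "x \<in> P_feasible V a b" "ereal (total_cost f x) < ereal (opt + e)"
    unfolding INF_less_iff by (rule bexE)
  then show thesis by (intro that) simp_all
qed

text \<open>Writes the optimal set as a sublevel set, the form used in the limit arguments.\<close>

lemma P_optimal_iff: "x \<in> P_optimal V f a b \<longleftrightarrow> x \<in> P_feasible V a b \<and> total_cost f x \<le> opt"
proof
  assume x: "x \<in> P_optimal V f a b"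
  then have min: "total_cost f x \<le> total_cost f z" if "z \<in> P_feasible V a b" for z
    using that by (auto simp: P_optimal_def is_arg_min_def not_less)
  have "total_cost f x \<le> opt + e" if e: "e > 0" for e
  proof -
    obtain z where "z \<in> P_feasible V a b" "total_cost f z < opt + e" by (rule opt_approx[OF e])
    with min[of z] show ?thesis by simp
  qed
  then have "total_cost f x \<le> opt" by (rule field_le_epsilon)
  with x show "x \<in> P_feasible V a b \<and> total_cost f x \<le> opt"
    by (simp add: P_optimal_def is_arg_min_def)
next
  assume "x \<in> P_feasible V a b \<and> total_cost f x \<le> opt"
  then show "x \<in> P_optimal V f a b"
    using opt_le by (force simp: P_optimal_def is_arg_min_def not_less)
qed

section \<open>Optimal values of the local problems\<close>

definition q :: "'i \<Rightarrow> (real ^ 'm) ^ 'i \<Rightarrow> real" where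
  "q i v = real_of_ereal (INF z \<in> SL_feasible V a b E v i. ereal (f i z))"

text \<open>Finiteness of (P) carries over: with the other agents fixed at locally feasible points,
  each local point completes to a feasible point of (P), so its cost cannot fall below
  \<open>l\<close>.\<close>

lemma q_eq: "(INF z \<in> SL_feasible V a b E v i. ereal (f i z)) = ereal (q i v)"
proof -
  have "\<exists>z. z \<in> SL_feasible V a b E v j" for j using feasible by blast
  then obtain z where z: "\<And>j. z j \<in> SL_feasible V a b E v j" by metis
  define l where "l = opt - (\<Sum>j\<in>UNIV - {i}. f j (z j))"
  have "l \<le> f i w" if w: "w \<in> SL_feasible V a b E v i" for w
  proof -
    define x where "x = (\<chi> j. if j = i then w else z j)"
    have "x \<in> P_feasible V a b"
      by (rule local_feasible_imp_feasible[of _ v]) (use z w in \<open>simp add: x_def\<close>)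
    then have "opt \<le> total_cost f x" by (rule opt_le)
    also have "\<dots> = f i (x $ i) + (\<Sum>j\<in>UNIV - {i}. f j (x $ j))"
      unfolding total_cost_def by (rule sum.remove) auto
    also have "\<dots> = f i w + (\<Sum>j\<in>UNIV - {i}. f j (z j))"
      by (simp add: x_def)
    finally show ?thesis by (simp add: l_def)
  qed
  then have "ereal l \<le> (INF z \<in> SL_feasible V a b E v i. ereal (f i z))"
    by (intro INF_greatest) simp
  moreover have "(INF z \<in> SL_feasible V a b E v i. ereal (f i z)) \<le> ereal (f i (z i))"
    using z by (rule INF_lower)
  ultimately have "\<bar>INF z \<in> SL_feasible V a b E v i. ereal (f i z)\<bar> \<noteq> \<infinity>"
    by auto
  then show ?thesis by (simp add: q_def ereal_real)
qed

lemma q_le: "z \<in> SL_feasible V a b E v i \<Longrightarrow> q i v \<le> f i z"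
  using INF_lower[of z "SL_feasible V a b E v i" "\<lambda>z. ereal (f i z)"] by (simp add: q_eq)

lemma q_approx:
  assumes "e > 0"
  obtains z where "z \<in> SL_feasible V a b E v i" "f i z < q i v + e"
proof -
  have "(INF z \<in> SL_feasible V a b E v i. ereal (f i z)) < ereal (q i v + e)"
    using q_eq assms by simp
  then obtain z where "z \<in> SL_feasible V a b E v i" "ereal (f i z) < ereal (q i v + e)"
    unfolding INF_less_iff by (rule bexE)
  then show thesis by (intro that) simp_all
qed

lemma SL_optimal_iff: "z \<in> SL_optimal V f a b E v i \<longleftrightarrow> z \<in> SL_feasible V a b E v i \<and> f i z \<le> q i v"
proof
  assume z: "z \<in> SL_optimal V f a b E v i"
  then have min: "f i z \<le> f i w" if "w \<in> SL_feasible V a b E v i" for w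
    using that by (auto simp: SL_optimal_def is_arg_min_def not_less)
  have "f i z \<le> q i v + e" if e: "e > 0" for e
  proof -
    obtain w where "w \<in> SL_feasible V a b E v i" "f i w < q i v + e" by (rule q_approx[OF e])
    with min[of w] show ?thesis by simp
  qed
  then have "f i z \<le> q i v" by (rule field_le_epsilon)
  with z show "z \<in> SL_feasible V a b E v i \<and> f i z \<le> q i v"
    by (simp add: SL_optimal_def is_arg_min_def)
next
  assume "z \<in> SL_feasible V a b E v i \<and> f i z \<le> q i v"
  then show "z \<in> SL_optimal V f a b E v i"
    using q_le by (force simp: SL_optimal_def is_arg_min_def not_less)
qed

lemma SL_optimal_value: "z \<in> SL_optimal V f a b E v i \<Longrightarrow> f i z = q i v"
  using q_le by (auto simp: SL_optimal_iff intro: antisym)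

section \<open>Multipliers as sensitivities\<close>

lemma multiplier_nonneg: "m \<in> active_constraints a b i \<Longrightarrow> c v $ i $ m \<ge> 0"
  using multiplier[of v i] by (simp add: SL_multiplier_def)

lemma q_le_lagrangian:
  assumes "z \<in> V i"
  shows "q i v \<le> f i z + (\<Sum>m\<in>active_constraints a b i. c v $ i $ m * local_constraint a b E v i m z)"
proof -
  have "ereal (q i v) = (INF z \<in> V i. ereal (f i z +
        (\<Sum>m \<in> active_constraints a b i. c v $ i $ m * local_constraint a b E v i m z)))"
    using multiplier[of v i] by (simp add: SL_multiplier_def q_eq)
  also have "\<dots> \<le> ereal (f i z +
        (\<Sum>m \<in> active_constraints a b i. c v $ i $ m * local_constraint a b E v i m z))"
    using assms by (rule INF_lower)
  finally show ?thesis by simp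
qed

text \<open>A nearly optimal point at \<open>w\<close> is inserted into the Lagrangian at
  \<open>v\<close>. Its constraints at \<open>v\<close> and at \<open>w\<close> differ by exactly
  \<open>lap (w - v)\<close>, and at \<open>w\<close> they are nonpositive against nonnegative
  multipliers.\<close>

lemma q_subgradient:
  "q i v + (\<Sum>m\<in>active_constraints a b i. c v $ i $ m * lap (w - v) i m) \<le> q i w"
proof (rule field_le_epsilon)
  fix e :: real assume "e > 0"
  then obtain z where z: "z \<in> SL_feasible V a b E w i" "f i z < q i w + e" by (rule q_approx)
  let ?A = "active_constraints a b i"
  have "q i v + (\<Sum>m\<in>?A. c v $ i $ m * lap (w - v) i m) \<le> f i z +
      (\<Sum>m\<in>?A. c v $ i $ m * local_constraint a b E v i m z) + (\<Sum>m\<in>?A. c v $ i $ m * lap (w - v) i m)"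
    using q_le_lagrangian[of z i v] z(1) by (simp add: SL_feasible_def)
  also have "\<dots> = f i z + (\<Sum>m\<in>?A. c v $ i $ m * local_constraint a b E w i m z)"
    unfolding add.assoc sum.distrib[symmetric]
    by (simp add: local_constraint_eq linear_diff[OF linear_lap] algebra_simps)
  also have "(\<Sum>m\<in>?A. c v $ i $ m * local_constraint a b E w i m z) \<le> 0"
    using z(1) by (intro sum_nonpos mult_nonneg_nonpos multiplier_nonneg) (auto simp: SL_feasible_def)
  finally show "q i v + (\<Sum>m\<in>?A. c v $ i $ m * lap (w - v) i m) \<le> q i w + e" using z(2) by simp
qed

text \<open>The linear form of the sensitivity inequality is represented as an inner product by its
  adjoint at 1, which exhibits a subgradient selection for \<open>q i\<close>.\<close>

lemma q_continuous: "continuous_on UNIV (q i)"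
proof -
  define h where "h v w = (\<Sum>m\<in>active_constraints a b i. c v $ i $ m * lap w i m)" for v w
  have h: "linear (h v)" for v
    unfolding h_def
    by (rule linearI) (simp_all add: linear_add[OF linear_lap] linear_scale[OF linear_lap]
        sum.distrib distrib_left sum_distrib_left mult.left_commute)
  interpret subgradient_selection "q i" "\<lambda>v. adjoint (h v) 1"
  proof
    fix v w
    have "adjoint (h v) 1 \<bullet> (w - v) = h v (w - v)"
      using adjoint_works[OF h, of "w - v" v 1] by (simp add: inner_commute)
    then show "q i v + adjoint (h v) 1 \<bullet> (w - v) \<le> q i w"
      using q_subgradient[of i v w] by (simp add: h_def)
  qed
  show ?thesis by (rule continuous)
qed

section \<open>The total value function and its infimum\<close>

definition p :: "(real ^ 'm) ^ 'i \<Rightarrow> real" where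
  "p v = (\<Sum>i\<in>UNIV. q i v)"

text \<open>The update law without its factor \<open>- k\<close>: the Laplacian applied to the
  multipliers.\<close>

definition G :: "(real ^ 'm) ^ 'i \<Rightarrow> (real ^ 'm) ^ 'i" where
  "G v = (\<chi> i m. if m \<in> active_constraints a b i then \<Sum>j\<in>nb i m. c v $ i $ m - c v $ j $ m else 0)"

lemma update_law_eq: "update_law a b E k c = (\<lambda>v. - k *\<^sub>R G v)"
  by (simp add: fun_eq_iff vec_eq_iff update_law_def G_def active_neighbors_def)

text \<open>Summation by parts works one constraint at a time, so the sums over agents and
  constraints are exchanged before it and exchanged back after it.\<close>

sublocale subgradient_selection p G
proof
  fix v w
  have swap: "(\<Sum>i\<in>UNIV. \<Sum>m\<in>active_constraints a b i. h i m) =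
      (\<Sum>m\<in>UNIV. \<Sum>i\<in>active_agents a b m. h i m)" for h :: "'i \<Rightarrow> 'm \<Rightarrow> real"
    using sum.swap_restrict[of "UNIV :: 'i set" "UNIV :: 'm set" h "\<lambda>i m. m \<in> active_constraints a b i"]
    by (simp add: active_iff active_constraints_eq)
  have "(\<Sum>i\<in>UNIV. \<Sum>m\<in>active_constraints a b i. c v $ i $ m * lap (w - v) i m) =
      (\<Sum>m\<in>UNIV. \<Sum>i\<in>active_agents a b m. c v $ i $ m * lap (w - v) i m)"
    by (rule swap)
  also have "\<dots> = (\<Sum>m\<in>UNIV. \<Sum>i\<in>active_agents a b m. (w - v) $ i $ m * (\<Sum>j\<in>nb i m. c v $ i $ m - c v $ j $ m))"
    unfolding lap_def by (intro sum.cong refl laplacian_sum_by_parts[OF sym])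
  also have "\<dots> = (\<Sum>i\<in>UNIV. \<Sum>m\<in>active_constraints a b i. (w - v) $ i $ m * (\<Sum>j\<in>nb i m. c v $ i $ m - c v $ j $ m))"
    by (rule swap[symmetric])
  also have "\<dots> = (\<Sum>i\<in>UNIV. \<Sum>m\<in>UNIV. G v $ i $ m * (w - v) $ i $ m)"
    by (intro sum.cong refl sum.mono_neutral_cong_left) (auto simp: G_def)
  also have "\<dots> = G v \<bullet> (w - v)" by (simp add: inner_vec_def)
  finally have eq: "(\<Sum>i\<in>UNIV. \<Sum>m\<in>active_constraints a b i. c v $ i $ m * lap (w - v) i m) = G v \<bullet> (w - v)" .
  show "p v + G v \<bullet> (w - v) \<le> p w"
    unfolding p_def eq[symmetric] sum.distrib[symmetric] by (intro sum_mono q_subgradient)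
qed

text \<open>Local minima may not be attained, so nearly optimal local points are stacked, each agent
  being allowed an equal share \<open>d\<close> of the error.\<close>

lemma opt_le_p: "opt \<le> p v"
proof (rule field_le_epsilon)
  fix e :: real assume e: "e > 0"
  define d where "d = e / CARD('i)"
  have "d > 0" using e by (simp add: d_def)
  then have "\<exists>z. z \<in> SL_feasible V a b E v i \<and> f i z < q i v + d" for i
    using q_approx by metis
  then obtain z where z: "\<And>i. z i \<in> SL_feasible V a b E v i" "\<And>i. f i (z i) < q i v + d"
    by metis
  have "(\<chi> i. z i) \<in> P_feasible V a b"
    by (rule local_feasible_imp_feasible[of _ v]) (simp add: z(1))
  then have "opt \<le> (\<Sum>i\<in>UNIV. f i (z i))" using opt_le by (force simp: total_cost_def)
  also have "\<dots> \<le> (\<Sum>i\<in>UNIV. q i v + d)"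
    using z(2) by (intro sum_mono less_imp_le)
  also have "\<dots> = p v + e" by (simp add: p_def sum.distrib d_def)
  finally show "opt \<le> p v + e" .
qed

lemma p_le_total_cost:
  "(\<And>i. x $ i \<in> SL_feasible V a b E v i) \<Longrightarrow> p v \<le> total_cost f x"
  unfolding p_def total_cost_def by (intro sum_mono q_le)

text \<open>Together with \<open>opt_le_p\<close> this identifies \<open>opt\<close> as the infimum
  of \<open>p\<close>.\<close>

lemma p_approx:
  assumes "e > 0"
  shows "\<exists>v. p v < opt + e"
proof -
  obtain x where x: "x \<in> P_feasible V a b" "total_cost f x < opt + e"
    by (rule opt_approx[OF assms])
  obtain v where "\<forall>i. x $ i \<in> SL_feasible V a b E v i"
    using feasible_imp_local_feasible[OF x(1)] by blast
  then have "p v \<le> total_cost f x" by (intro p_le_total_cost) simp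
  with x(2) show ?thesis by (intro exI[of _ v]) simp
qed

section \<open>From minimizers of the total value to optimal points\<close>

lemma SL_optimal_total_cost:
  "(\<And>i. x $ i \<in> SL_optimal V f a b E v i) \<Longrightarrow> total_cost f x = p v"
  unfolding p_def total_cost_def by (intro sum.cong refl SL_optimal_value)

lemma SL_optimal_imp_P_feasible:
  assumes "\<And>i. x $ i \<in> SL_optimal V f a b E v i"
  shows "x \<in> P_feasible V a b"
  by (rule local_feasible_imp_feasible[of _ v]) (use assms in \<open>simp add: SL_optimal_iff\<close>)

lemma SL_optimal_imp_P_optimal:
  assumes "p v = opt" "\<And>i. x $ i \<in> SL_optimal V f a b E v i"
  shows "x \<in> P_optimal V f a b"
  using SL_optimal_imp_P_feasible[OF assms(2)] SL_optimal_total_cost[OF assms(2)] assms(1) by (simp add: P_optimal_iff)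

lemma minimizer_exists:
  assumes "P_optimal V f a b \<noteq> {}"
  obtains v where "p v = opt"
proof -
  obtain x where x: "x \<in> P_feasible V a b" "total_cost f x \<le> opt"
    using assms by (auto simp: P_optimal_iff)
  obtain v where "\<forall>i. x $ i \<in> SL_feasible V a b E v i"
    using feasible_imp_local_feasible[OF x(1)] by blast
  then have "p v \<le> total_cost f x" by (intro p_le_total_cost) simp
  then have "p v \<le> opt" using x(2) by simp
  then show thesis using opt_le_p[of v] by (intro that antisym)
qed

text \<open>Optimality for (SR) asks for an attained minimum in \<open>x\<close> as well; stacked
  local solutions at \<open>v\<close> provide it.\<close>

lemma minimizer_in_SR_optimal_y:
  assumes "p v = opt" "\<And>i. SL_optimal V f a b E v i \<noteq> {}"
  shows "v \<in> SR_optimal_y V f a b E"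
proof -
  have "\<exists>z. z \<in> SL_optimal V f a b E v i" for i using assms(2) by blast
  then obtain z where z: "\<And>i. z i \<in> SL_optimal V f a b E v i" by metis
  define x where "x = (\<chi> i. z i)"
  have SR: "(x, v) \<in> SR_feasible V a b E \<longleftrightarrow> (\<forall>i. x $ i \<in> SL_feasible V a b E v i)" for x v
    by (auto simp: SR_feasible_def SL_feasible_def)
  have x: "x $ i \<in> SL_optimal V f a b E v i" for i by (simp add: x_def z)
  have "total_cost f x = opt" using SL_optimal_total_cost[of x v] x assms(1) by simp
  moreover have "opt \<le> total_cost f x'" if "(x', v') \<in> SR_feasible V a b E" for x' v'
    using that local_feasible_imp_feasible[of x' v'] opt_le by (simp add: SR)
  moreover have "(x, v) \<in> SR_feasible V a b E" using x by (simp add: SR SL_optimal_iff)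
  ultimately have "is_arg_min (\<lambda>(x, y). total_cost f x) (\<lambda>p. p \<in> SR_feasible V a b E) (x, v)"
    by (auto simp: is_arg_min_def not_less)
  then show ?thesis by (auto simp: SR_optimal_y_def)
qed

section \<open>Convexity, closedness and continuity\<close>

lemma continuous_on_f: "continuous_on (V i) (f i)"
  using subspace convex by (rule convex_on_subspace_continuous)

lemma convex_P_feasible: "convex (P_feasible V a b)"
proof (rule convexI)
  fix x y u w assume xy: "x \<in> P_feasible V a b" "y \<in> P_feasible V a b"
    and uw: "0 \<le> u" "0 \<le> w" "u + w = (1 :: real)"
  have "(u *\<^sub>R x + w *\<^sub>R y) $ i \<in> V i" for i
    using xy subspace[of i] by (auto simp: P_feasible_def intro!: subspace_add subspace_scale)
  moreover have "(\<Sum>i\<in>UNIV. a i m \<bullet> (u *\<^sub>R x + w *\<^sub>R y) $ i + b i m) \<le> 0" for m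
  proof -
    have "(\<Sum>i\<in>UNIV. a i m \<bullet> (u *\<^sub>R x + w *\<^sub>R y) $ i + b i m) =
        (\<Sum>i\<in>UNIV. u * (a i m \<bullet> x $ i + b i m) + w * (a i m \<bullet> y $ i + b i m))"
    proof (rule sum.cong[OF refl])
      fix i
      have "b i m = u * b i m + w * b i m" using uw(3) by (simp flip: distrib_right)
      then show "a i m \<bullet> (u *\<^sub>R x + w *\<^sub>R y) $ i + b i m =
          u * (a i m \<bullet> x $ i + b i m) + w * (a i m \<bullet> y $ i + b i m)"
        by (simp add: inner_add_right distrib_left)
    qed
    also have "\<dots> = u * (\<Sum>i\<in>UNIV. a i m \<bullet> x $ i + b i m) + w * (\<Sum>i\<in>UNIV. a i m \<bullet> y $ i + b i m)"
      unfolding sum_distrib_left sum.distrib[symmetric] by (rule refl)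
    also have "\<dots> \<le> 0"
      using xy uw by (intro add_nonpos_nonpos mult_nonneg_nonpos) (simp_all only: P_feasible_def mem_Collect_eq)
    finally show ?thesis .
  qed
  ultimately show "u *\<^sub>R x + w *\<^sub>R y \<in> P_feasible V a b" by (simp add: P_feasible_def)
qed

lemma closed_P_feasible: "closed (P_feasible V a b)"
proof -
  have "closed {x. (x :: 'v ^ 'i) $ i \<in> V i}" for i
    using continuous_closed_vimage[OF closed_subspace[OF subspace, of i], of "\<lambda>x. x $ i"]
    by (simp add: vimage_def continuous_intros)
  moreover have "closed {x :: 'v ^ 'i. (\<Sum>i\<in>UNIV. a i m \<bullet> (x $ i) + b i m) \<le> 0}" for m
    by (intro closed_Collect_le continuous_intros)
  ultimately have "closed ((\<Inter>i. {x. (x :: 'v ^ 'i) $ i \<in> V i}) \<inter>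
      (\<Inter>m. {x. (\<Sum>i\<in>UNIV. a i m \<bullet> (x $ i) + b i m) \<le> 0}))"
    by (intro closed_Int closed_INT) auto
  also have "(\<Inter>i. {x. (x :: 'v ^ 'i) $ i \<in> V i}) \<inter>
      (\<Inter>m. {x. (\<Sum>i\<in>UNIV. a i m \<bullet> (x $ i) + b i m) \<le> 0}) = P_feasible V a b"
    by (auto simp: P_feasible_def)
  finally show ?thesis .
qed

lemma continuous_on_total_cost: "continuous_on (P_feasible V a b) (total_cost f)"
proof -
  have "continuous_on (P_feasible V a b) (\<lambda>x. f i (x $ i))" for i
    by (rule continuous_on_compose2[OF continuous_on_f])
      (auto intro!: continuous_intros simp: P_feasible_def)
  then show ?thesis unfolding total_cost_def by (intro continuous_on_sum)
qed

lemma convex_on_total_cost: "convex_on (P_feasible V a b) (total_cost f)"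
proof (rule convex_onI)
  fix t :: real and x y assume t: "0 < t" "t < 1" and xy: "x \<in> P_feasible V a b" "y \<in> P_feasible V a b"
  have "f i (((1 - t) *\<^sub>R x + t *\<^sub>R y) $ i) \<le> (1 - t) * f i (x $ i) + t * f i (y $ i)" for i
    using t xy convex_onD[OF convex[of i], of t "x $ i" "y $ i"] by (simp add: P_feasible_def)
  then have "total_cost f ((1 - t) *\<^sub>R x + t *\<^sub>R y) \<le> (\<Sum>i\<in>UNIV. (1 - t) * f i (x $ i) + t * f i (y $ i))"
    unfolding total_cost_def by (intro sum_mono)
  then show "total_cost f ((1 - t) *\<^sub>R x + t *\<^sub>R y) \<le> (1 - t) * total_cost f x + t * total_cost f y"
    by (simp add: total_cost_def sum.distrib sum_distrib_left)
qed (rule convex_P_feasible)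

text \<open>\<Phi> penalizes excess cost and constraint violation for the problem at the limit
  \<open>l\<close>, so its zero sublevel set is the optimal set there. Solutions at
  \<open>y t\<close> violate the problem at \<open>l\<close> only by the change of the data.\<close>

lemma SL_solutions_tendsto:
  assumes y: "(y \<longlongrightarrow> l) F"
    and x: "eventually (\<lambda>t. x t \<in> SL_optimal V f a b E (y t) i) F"
    and K: "SL_optimal V f a b E l i \<noteq> {}" "bounded (SL_optimal V f a b E l i)"
  shows "((\<lambda>t. infdist (x t) (SL_optimal V f a b E l i)) \<longlongrightarrow> 0) F"
proof -
  let ?A = "active_constraints a b i"
  define \<Phi> where "\<Phi> z = max 0 (f i z - q i l) + (\<Sum>m\<in>?A. max 0 (local_constraint a b E l i m z))" for z
  have cv: "convex (V i)" by (rule subspace_imp_convex[OF subspace])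
  have "convex_on (V i) (\<lambda>z. f i z + - q i l)"
    using convex cv by (intro convex_on_add) (simp_all add: convex_on_const)
  moreover have "convex_on (V i) (\<lambda>z. local_constraint a b E l i m z)" for m
  proof (rule convex_onI[OF _ cv])
    fix t :: real and z w
    have eq: "\<beta> = (1 - t) * \<beta> + t * \<beta>" for \<beta> by (simp add: algebra_simps)
    show "local_constraint a b E l i m ((1 - t) *\<^sub>R z + t *\<^sub>R w) \<le>
        (1 - t) * local_constraint a b E l i m z + t * local_constraint a b E l i m w"
      unfolding local_constraint_eq using eq[of "lap l i m"] eq[of "b i m"]
      by (simp only: inner_add_right inner_scaleR_right distrib_left)
  qed
  ultimately have conv: "convex_on (V i) \<Phi>"
    unfolding \<Phi>_def using cv by (intro convex_on_add convex_on_sum_functions convex_on_pos_part) auto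
  show ?thesis
  proof (rule infdist_sublevel_tendsto_0[OF closed_subspace[OF subspace] conv
        convex_on_subspace_continuous[OF subspace conv] _ K])
    have nn: "(\<Sum>m\<in>?A. max 0 (local_constraint a b E l i m z)) \<ge> 0" for z by (intro sum_nonneg) simp
    have "\<Phi> z \<le> 0 \<longleftrightarrow> f i z \<le> q i l \<and> (\<forall>m\<in>?A. local_constraint a b E l i m z \<le> 0)" for z
    proof -
      have "\<Phi> z \<le> 0 \<longleftrightarrow> \<Phi> z = 0" using nn[of z] by (auto simp: \<Phi>_def)
      also have "\<dots> \<longleftrightarrow> max 0 (f i z - q i l) = 0 \<and> (\<Sum>m\<in>?A. max 0 (local_constraint a b E l i m z)) = 0"
        unfolding \<Phi>_def by (rule add_nonneg_eq_0_iff) (use nn in auto)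
      also have "\<dots> \<longleftrightarrow> f i z \<le> q i l \<and> (\<forall>m\<in>?A. local_constraint a b E l i m z \<le> 0)"
        by (subst sum_nonneg_eq_0_iff) (auto simp: max_def)
      finally show ?thesis .
    qed
    then show "SL_optimal V f a b E l i = {z \<in> V i. \<Phi> z \<le> 0}"
      by (auto simp: SL_optimal_iff SL_feasible_def)
    show "eventually (\<lambda>t. x t \<in> V i) F"
      using x by eventually_elim (simp add: SL_optimal_iff SL_feasible_def)
    fix e :: real assume e: "e > 0"
    \<comment> \<open>A bound for the penalty of a solution that depends on the auxiliary variables
      alone; it is continuous at \<open>l\<close> and vanishes there.\<close>
    define B where "B v = max 0 (q i v - q i l) + (\<Sum>m\<in>?A. max 0 (lap l i m - lap v i m))" for v
    have "isCont (q i) l" using q_continuous by (simp add: continuous_on_eq_continuous_at)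
    moreover have "isCont (\<lambda>v. lap v i m) l" for m by (rule linear_continuous_at[OF linear_lap[unfolded linear_conv_bounded_linear]])
    ultimately have "isCont B l" unfolding B_def by (intro continuous_intros)
    then have "((\<lambda>t. B (y t)) \<longlongrightarrow> B l) F" using y by (rule isCont_tendsto_compose)
    then have "eventually (\<lambda>t. B (y t) < e) F" using e by (intro order_tendstoD) (auto simp: B_def)
    with x show "eventually (\<lambda>t. \<Phi> (x t) < e) F"
    proof eventually_elim
      case (elim t)
      have "local_constraint a b E l i m (x t) \<le> lap l i m - lap (y t) i m" if "m \<in> ?A" for m
        using elim(1) that by (force simp: SL_optimal_iff SL_feasible_def local_constraint_eq)
      then have "\<Phi> (x t) \<le> B (y t)"
        unfolding \<Phi>_def B_def SL_optimal_value[OF elim(1)] by (intro add_mono sum_mono max.mono) auto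
      with elim(2) show ?case by simp
    qed
  qed
qed

end

section \<open>Convergence of the update law\<close>

locale sparse_update = sparse_problem V f a b E c
  for V :: "'i::finite \<Rightarrow> 'v::euclidean_space set" and f
    and a :: "'i \<Rightarrow> 'm::finite \<Rightarrow> 'v" and b E c +
  fixes k :: real and y :: "real \<Rightarrow> (real ^ 'm) ^ 'i"
  assumes gain: "k > 0"
    and y_solution: "caratheodory_solution (update_law a b E k c) y"
begin

sublocale subgradient_flow p G k y
  using gain y_solution by unfold_locales (simp_all add: update_law_eq)

section \<open>Convergence of the auxiliary variables\<close>

lemma p_tendsto: "((\<lambda>t. p (y t)) \<longlongrightarrow> opt) at_top"
  by (rule value_tendsto_inf[OF opt_le_p p_approx])

lemma y_converges:
  assumes "P_optimal V f a b \<noteq> {}"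
  obtains l where "p l = opt" "(y \<longlongrightarrow> l) at_top"
proof -
  obtain z where z: "p z = opt" by (rule minimizer_exists[OF assms])
  then obtain l where l: "\<And>v. p l \<le> p v" "(y \<longlongrightarrow> l) at_top"
    using converges_to_minimizer[of z] opt_le_p by metis
  have "p l = opt" using l(1)[of z] z opt_le_p[of l] by simp
  with l(2) show thesis by (rule that[rotated])
qed

lemma SR_convergence:
  assumes "P_optimal V f a b \<noteq> {}" "\<And>v i. SL_optimal V f a b E v i \<noteq> {}"
  shows "SR_optimal_y V f a b E \<noteq> {}"
    and "((\<lambda>t. infdist (y t) (SR_optimal_y V f a b E)) \<longlongrightarrow> 0) at_top"
proof -
  obtain l where l: "p l = opt" "(y \<longlongrightarrow> l) at_top" by (rule y_converges[OF assms(1)])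
  have mem: "l \<in> SR_optimal_y V f a b E" by (rule minimizer_in_SR_optimal_y[OF l(1) assms(2)])
  then show "SR_optimal_y V f a b E \<noteq> {}" by blast
  have "((\<lambda>t. dist (y t) l) \<longlongrightarrow> 0) at_top" using l(2) by (simp flip: tendsto_dist_iff)
  then show "((\<lambda>t. infdist (y t) (SR_optimal_y V f a b E)) \<longlongrightarrow> 0) at_top"
    by (rule tendsto_sandwich[rotated 3]) (auto simp: infdist_nonneg infdist_le[OF mem])
qed

section \<open>Convergence of the local solutions\<close>

context
  fixes x :: "real \<Rightarrow> 'v ^ 'i"
  assumes x: "\<And>t i. t \<ge> 0 \<Longrightarrow> x t $ i \<in> SL_optimal V f a b E (y t) i"
begin

lemma x_feasible: "t \<ge> 0 \<Longrightarrow> x t \<in> P_feasible V a b"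
  by (rule SL_optimal_imp_P_feasible[OF x])

lemma cost_tendsto: "((\<lambda>t. total_cost f (x t)) \<longlongrightarrow> opt) at_top"
proof (rule Lim_transform_eventually[OF p_tendsto])
  show "eventually (\<lambda>t. p (y t) = total_cost f (x t)) at_top"
    using eventually_ge_at_top[of 0] by eventually_elim (simp add: SL_optimal_total_cost[OF x])
qed

lemma cluster_point_optimal:
  assumes s: "filterlim s at_top sequentially" and z: "(\<lambda>n. x (s n)) \<longlonglongrightarrow> z"
  shows "z \<in> P_optimal V f a b"
proof -
  have "eventually (\<lambda>n. s n \<ge> 0) sequentially" using s by (simp add: filterlim_at_top)
  then have ev: "eventually (\<lambda>n. x (s n) \<in> P_feasible V a b) sequentially"
    by eventually_elim (rule x_feasible)
  have zf: "z \<in> P_feasible V a b"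
    by (rule Lim_in_closed_set[OF closed_P_feasible ev _ z]) simp
  have "(\<lambda>n. total_cost f (x (s n))) \<longlonglongrightarrow> total_cost f z"
    by (rule continuous_on_tendsto_compose[OF continuous_on_total_cost z zf ev])
  moreover have "(\<lambda>n. total_cost f (x (s n))) \<longlonglongrightarrow> opt"
    by (rule filterlim_compose[OF cost_tendsto s])
  ultimately have "total_cost f z = opt" by (rule LIMSEQ_unique)
  with zf show ?thesis by (simp add: P_optimal_iff)
qed

text \<open>The excess of the cost over \<open>opt\<close> is convex on the closed feasible set, has
  the optimal set as its zero sublevel set, and tends to zero along \<open>x\<close>.\<close>

lemma infdist_optimal_tendsto_if_bounded:
  assumes "P_optimal V f a b \<noteq> {}" "bounded (P_optimal V f a b)"
  shows "((\<lambda>t. infdist (x t) (P_optimal V f a b)) \<longlongrightarrow> 0) at_top"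
proof (rule infdist_sublevel_tendsto_0[where \<Phi> = "\<lambda>x. total_cost f x + - opt", OF closed_P_feasible])
  show "convex_on (P_feasible V a b) (\<lambda>x. total_cost f x + - opt)"
    by (intro convex_on_add convex_on_total_cost) (simp add: convex_on_const convex_P_feasible)
  show "continuous_on (P_feasible V a b) (\<lambda>x. total_cost f x + - opt)"
    by (intro continuous_intros continuous_on_total_cost)
  show "P_optimal V f a b = {x \<in> P_feasible V a b. total_cost f x + - opt \<le> 0}"
    by (auto simp: P_optimal_iff)
  show "eventually (\<lambda>t. x t \<in> P_feasible V a b) at_top"
    using eventually_ge_at_top[of 0] by eventually_elim (rule x_feasible)
  show "eventually (\<lambda>t. total_cost f (x t) + - opt < e) at_top" if "e > 0" for e
    using order_tendstoD(2)[OF cost_tendsto, of "opt + e"] that by (simp add: algebra_simps)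
qed fact+

lemma local_solution_tendsto:
  assumes "(y \<longlongrightarrow> l) at_top" "SL_optimal V f a b E l i \<noteq> {}" "bounded (SL_optimal V f a b E l i)"
  shows "((\<lambda>t. infdist (x t $ i) (SL_optimal V f a b E l i)) \<longlongrightarrow> 0) at_top"
  by (rule SL_solutions_tendsto[OF assms(1) _ assms(2,3)])
    (use eventually_ge_at_top[of 0] in eventually_elim, rule x)

text \<open>Works agent by agent: each component approaches its local optimal set at the limit
  \<open>l\<close> of \<open>y\<close>, and every stacking of points from these sets is optimal for
  (P).\<close>

lemma infdist_optimal_tendsto_if_local_bounded:
  assumes "P_optimal V f a b \<noteq> {}"
    and ne: "\<And>v i. SL_optimal V f a b E v i \<noteq> {}" and bd: "\<And>v i. bounded (SL_optimal V f a b E v i)"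
  shows "((\<lambda>t. infdist (x t) (P_optimal V f a b)) \<longlongrightarrow> 0) at_top"
proof -
  obtain l where l: "p l = opt" "(y \<longlongrightarrow> l) at_top" by (rule y_converges[OF assms(1)])
  show ?thesis
  proof (rule tendstoI)
    fix e :: real assume e: "e > 0"
    \<comment> \<open>The distance of stacked vectors is at most the sum of the distances of the
      components, so each agent gets an equal share of \<open>e\<close>.\<close>
    define d where "d = e / CARD('i)"
    have d: "d > 0" using e by (simp add: d_def)
    have "eventually (\<lambda>t. infdist (x t $ i) (SL_optimal V f a b E l i) < d) at_top" for i
      using order_tendstoD(2)[OF local_solution_tendsto[OF l(2) ne bd] d] .
    then have "eventually (\<lambda>t. \<forall>i. infdist (x t $ i) (SL_optimal V f a b E l i) < d) at_top"
      by (rule eventually_all_finite)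
    then show "eventually (\<lambda>t. dist (infdist (x t) (P_optimal V f a b)) 0 < e) at_top"
    proof eventually_elim
      case (elim t)
      then have "\<exists>z. z \<in> SL_optimal V f a b E l i \<and> dist (x t $ i) z < d" for i
        using ne infdist_lessE by metis
      then obtain z where z: "\<And>i. z i \<in> SL_optimal V f a b E l i" "\<And>i. dist (x t $ i) (z i) < d"
        by metis
      have "(\<chi> i. z i) \<in> P_optimal V f a b"
        by (rule SL_optimal_imp_P_optimal[OF l(1)]) (simp add: z(1))
      then have "infdist (x t) (P_optimal V f a b) \<le> dist (x t) (\<chi> i. z i)" by (rule infdist_le)
      also have "\<dots> \<le> (\<Sum>i\<in>UNIV. dist (x t $ i) ((\<chi> i. z i) $ i))" by (rule dist_vec_le_sum)
      also have "\<dots> < (\<Sum>i\<in>(UNIV :: 'i set). d)"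
        by (rule sum_strict_mono) (simp_all add: z(2))
      also have "\<dots> = e" by (simp add: d_def)
      finally show ?case by (simp add: infdist_nonneg)
    qed
  qed
qed

text \<open>When the local optimal sets at the limit of \<open>y\<close> are singletons, distance to
  a set becomes distance to a fixed point.\<close>

lemma tendsto_if_local_unique:
  assumes "P_optimal V f a b \<noteq> {}" and uniq: "\<And>v i. \<exists>!z. z \<in> SL_optimal V f a b E v i"
  shows "\<exists>x\<^sub>o \<in> P_optimal V f a b. (x \<longlongrightarrow> x\<^sub>o) at_top"
proof -
  obtain l where l: "p l = opt" "(y \<longlongrightarrow> l) at_top" by (rule y_converges[OF assms(1)])
  define z where "z i = (THE z. z \<in> SL_optimal V f a b E l i)" for i
  have z_mem: "z i \<in> SL_optimal V f a b E l i" for i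
    unfolding z_def using uniq by (rule theI')
  then have K: "SL_optimal V f a b E l i = {z i}" for i using uniq[of l i] by blast
  have "((\<lambda>t. dist (x t $ i) (z i)) \<longlongrightarrow> 0) at_top" for i
    using local_solution_tendsto[OF l(2), of i] unfolding K by (simp add: infdist_def)
  then have "((\<lambda>t. x t $ i) \<longlongrightarrow> z i) at_top" for i by (simp flip: tendsto_dist_iff)
  then have "(x \<longlongrightarrow> (\<chi> i. z i)) at_top" by (intro vec_tendstoI) simp
  moreover have "(\<chi> i. z i) \<in> P_optimal V f a b"
    by (rule SL_optimal_imp_P_optimal[OF l(1)]) (simp add: z_mem)
  ultimately show ?thesis by blast
qed

end

end

theorem theorem2:
  fixes V :: "'i::finite \<Rightarrow> 'v::euclidean_space set"
    and f :: "'i \<Rightarrow> 'v \<Rightarrow> real"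
    and a :: "'i \<Rightarrow> 'm::finite \<Rightarrow> 'v"
    and b :: "'i \<Rightarrow> 'm \<Rightarrow> real"
    and E :: "('i \<times> 'i) set"
    and c :: "(real ^ 'm) ^ 'i \<Rightarrow> (real ^ 'm) ^ 'i"
    and k\<^sub>0 :: real
    and y :: "real \<Rightarrow> (real ^ 'm) ^ 'i"
  assumes spaces: "\<And>i. subspace (V i)" "\<And>i m. a i m \<in> V i"
    and graph: "sym E" "irrefl E" "induced_connected UNIV E"
    and A1: "\<And>i. convex_on (V i) (f i)"
    and A2: "\<bar>P_value V f a b\<bar> \<noteq> \<infinity>"
    and A3: "\<And>v i. SL_strictly_feasible V a b E v i \<noteq> {}"
    and A4: "\<And>m. induced_connected (active_agents a b m) E"
    and multipliers: "\<And>v i. SL_multiplier V f a b E v i (c v $ i)"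
      "\<And>v i m. m \<notin> active_constraints a b i \<Longrightarrow> c v $ i $ m = 0"
    and gain: "k\<^sub>0 > 0"
    and solution: "caratheodory_solution (update_law a b E k\<^sub>0 c) y"
  shows
    "(\<forall>w. caratheodory_solution (update_law a b E k\<^sub>0 c) w \<and> w 0 = y 0 \<longrightarrow>
        (\<forall>t\<ge>0. w t = y t)) \<and>
     (P_optimal V f a b \<noteq> {} \<and> (\<forall>v i. SL_optimal V f a b E v i \<noteq> {}) \<longrightarrow>
        SR_optimal_y V f a b E \<noteq> {} \<and>
        ((\<lambda>t. infdist (y t) (SR_optimal_y V f a b E)) \<longlongrightarrow> 0) at_top) \<and>
     (\<forall>x :: real \<Rightarrow> 'v ^ 'i. (\<forall>t\<ge>0. \<forall>i. x t $ i \<in> SL_optimal V f a b E (y t) i) \<longrightarrow>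
        ((\<lambda>t. ereal (total_cost f (x t))) \<longlongrightarrow> P_value V f a b) at_top \<and>
        (\<forall>s z. filterlim s at_top sequentially \<and> (\<lambda>n::nat. x (s n)) \<longlonglongrightarrow> z \<longrightarrow>
          z \<in> P_optimal V f a b) \<and>
        (P_optimal V f a b \<noteq> {} \<and>
          (bounded (P_optimal V f a b) \<or>
           (\<forall>v i. SL_optimal V f a b E v i \<noteq> {} \<and> bounded (SL_optimal V f a b E v i))) \<longrightarrow>
          ((\<lambda>t. infdist (x t) (P_optimal V f a b)) \<longlongrightarrow> 0) at_top) \<and>
        (P_optimal V f a b \<noteq> {} \<and> (\<forall>v i. \<exists>!z. z \<in> SL_optimal V f a b E v i) \<longrightarrow>
          (\<exists>x\<^sub>o \<in> P_optimal V f a b. (x \<longlongrightarrow> x\<^sub>o) at_top))) \<and>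
     (\<forall>t\<ge>0. \<forall>x :: 'v ^ 'i. (\<forall>i. x $ i \<in> SL_optimal V f a b E (y t) i) \<longrightarrow>
        x \<in> P_feasible V a b)"
proof -
  have "SL_feasible V a b E v i \<noteq> {}" for v i
    using A3[of v i] by (force simp: SL_strictly_feasible_def SL_feasible_def less_imp_le)
  then interpret sparse_update V f a b E c k\<^sub>0 y
    using spaces graph A1 A2 A4 multipliers gain solution by unfold_locales
  show ?thesis
  proof (intro conjI allI impI)
    fix w t
    assume "caratheodory_solution (update_law a b E k\<^sub>0 c) w \<and> w 0 = y 0" "(0 :: real) \<le> t"
    then show "w t = y t" by (simp add: unique update_law_eq)
  next
    assume "P_optimal V f a b \<noteq> {} \<and> (\<forall>v i. SL_optimal V f a b E v i \<noteq> {})"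
    then show "SR_optimal_y V f a b E \<noteq> {}"
      and "((\<lambda>t. infdist (y t) (SR_optimal_y V f a b E)) \<longlongrightarrow> 0) at_top"
      by (intro SR_convergence; simp)+
  next
    fix t and x :: "'v ^ 'i"
    assume "\<forall>i. x $ i \<in> SL_optimal V f a b E (y t) i"
    then show "x \<in> P_feasible V a b" by (intro SL_optimal_imp_P_feasible[of _ "y t"]) simp
  next
    fix x :: "real \<Rightarrow> 'v ^ 'i"
    assume "\<forall>t\<ge>0. \<forall>i. x t $ i \<in> SL_optimal V f a b E (y t) i"
    then have x: "\<And>t i. t \<ge> 0 \<Longrightarrow> x t $ i \<in> SL_optimal V f a b E (y t) i" by simp
    show "((\<lambda>t. ereal (total_cost f (x t))) \<longlongrightarrow> P_value V f a b) at_top"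
      unfolding P_value_eq by (rule tendsto_ereal[OF cost_tendsto[OF x]])
    show "z \<in> P_optimal V f a b"
      if "filterlim s at_top sequentially \<and> (\<lambda>n::nat. x (s n)) \<longlonglongrightarrow> z" for s z
      using cluster_point_optimal[OF x] that by blast
    show "((\<lambda>t. infdist (x t) (P_optimal V f a b)) \<longlongrightarrow> 0) at_top"
      if "P_optimal V f a b \<noteq> {} \<and> (bounded (P_optimal V f a b) \<or>
           (\<forall>v i. SL_optimal V f a b E v i \<noteq> {} \<and> bounded (SL_optimal V f a b E v i)))"
    proof (cases "bounded (P_optimal V f a b)")
      case True
      with that show ?thesis by (intro infdist_optimal_tendsto_if_bounded[OF x]) simp_all
    next
      case False
      with that show ?thesis by (intro infdist_optimal_tendsto_if_local_bounded[OF x]) simp_all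
    qed
    show "\<exists>x\<^sub>o \<in> P_optimal V f a b. (x \<longlongrightarrow> x\<^sub>o) at_top"
      if "P_optimal V f a b \<noteq> {} \<and> (\<forall>v i. \<exists>!z. z \<in> SL_optimal V f a b E v i)"
      using that by (intro tendsto_if_local_unique[OF x]) simp_all
  qed
qed

end
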